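(* Let $E\subset\mathbb{R}^2$ be the open domain bounded by an ellipse whose ratio of major to minor semiaxis is $c\ge1$. Then \[ \max\left\{2,\ \frac{2\sqrt{c^2-1}\,\arcsin\sqrt{1-\frac{1}{c^2}}}{\log(2c^2-1)}\right\}\le A_E\le 2c^4, \] where for $c=1$ the second quantity inside the maximum is omitted.
   Context: For a domain $G\subsetneq\mathbb{R}^n$ let $d_G(x)=d(x,\partial G)$. The quasihyperbolic distance is $k_G(x,y)=\inf_\gamma\int_\gamma\frac{|dx|}{d_G(x)}$ over rectifiable curves $\gamma\subset G$ joining $x$ and $y$. The distance ratio metric is $j_G(x,y)=\log\left(1+\frac{|x-y|}{\min\{d_G(x),d_G(y)\}}\right)$. The uniformity constant is $A_G=\inf\{A\ge1: k_G(x,y)\le A\,j_G(x,y)\text{ for all }x,y\in G\}$ (with $\inf\emptyset=+\infty$). *)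

theory Defs
  imports "HOL-Analysis.Analysis"
begin

definition is_partition :: "(nat \<Rightarrow> real) \<Rightarrow> nat \<Rightarrow> real \<Rightarrow> real \<Rightarrow> bool" where
  "is_partition p n s t \<longleftrightarrow> p 0 = s \<and> p n = t \<and> (\<forall>i<n. p i \<le> p (Suc i))"

definition curve_length :: "(real \<Rightarrow> 'a::metric_space) \<Rightarrow> real \<Rightarrow> real \<Rightarrow> real" where
  "curve_length g s t =
     Sup {\<Sum>i<n. dist (g (p (Suc i))) (g (p i)) | p n. is_partition p n s t}"

definition rectifiable_path :: "(real \<Rightarrow> 'a::real_normed_vector) \<Rightarrow> bool" where
  "rectifiable_path g \<longleftrightarrow> path g \<and>
     bdd_above {\<Sum>i<n. dist (g (p (Suc i))) (g (p i)) | p n. is_partition p n 0 1}"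

text \<open>Arc-length integral of a continuous nonnegative f along a rectifiable path
  (supremum of lower Darboux sums with respect to arc length).\<close>
definition arclength_integral :: "('a::real_normed_vector \<Rightarrow> real) \<Rightarrow> (real \<Rightarrow> 'a) \<Rightarrow> real" where
  "arclength_integral f g =
     Sup {\<Sum>i<n. (INF t\<in>{p i..p (Suc i)}. f (g t)) * curve_length g (p i) (p (Suc i)) | p n.
            is_partition p n 0 1}"

definition bdist :: "'a::euclidean_space set \<Rightarrow> 'a \<Rightarrow> real" where
  "bdist G x = infdist x (frontier G)"

definition qh_dist :: "'a::euclidean_space set \<Rightarrow> 'a \<Rightarrow> 'a \<Rightarrow> real" where
  "qh_dist G x y = Inf {arclength_integral (\<lambda>z. 1 / bdist G z) g | g.
       rectifiable_path g \<and> path_image g \<subseteq> G \<and> pathstart g = x \<and> pathfinish g = y}"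

definition j_dist :: "'a::euclidean_space set \<Rightarrow> 'a \<Rightarrow> 'a \<Rightarrow> real" where
  "j_dist G x y = ln (1 + dist x y / min (bdist G x) (bdist G y))"

text \<open>Uniformity constant, as an extended real (Inf of the empty set is \<infinity>).\<close>
definition unif_const :: "'a::euclidean_space set \<Rightarrow> ereal" where
  "unif_const G = Inf {ereal A | A. A \<ge> 1 \<and> (\<forall>x\<in>G. \<forall>y\<in>G. qh_dist G x y \<le> A * j_dist G x y)}"

end

theory Submission
  imports Defs
begin

text \<open>
  Lower bounds: if \<open>F z - F w \<le> |z - w| max (1/d(z)) (1/d(w))\<close> on the domain, then the
  quasihyperbolic distance of two points is at least the difference of the values of \<open>F\<close>.
  For the bound 2, \<open>F\<close> is a function of the minor coordinate, since \<open>d\<close> is at most the distance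
  to the boundary of the strip that contains the ellipse, and the two points approach the ends of the minor axis.
  For the arcsine bound, \<open>F\<close> is a function of the major coordinate, since on a line
  orthogonal to the major axis \<open>d\<close> is largest on that axis, and the two points are the centres of
  curvature at the ends of the major axis.

  Upper bound: the unit disc satisfies \<open>\<rho> \<le> 2 j\<close> for the hyperbolic metric \<open>\<rho>\<close> of density
  \<open>2 / (1 - |z|\<^sup>2) \<ge> 1 / (1 - |z|)\<close>. The linear map of the disc onto the ellipse, applied to
  hyperbolic geodesics, costs a factor \<open>c\<close> in the length and a factor \<open>c\<close> in \<open>j\<close>; this gives
  even \<open>2 c\<^sup>2\<close>.
\<close>

section \<open>Curve length and arc-length integrals\<close>

text \<open>The set under the \<open>Sup\<close> of \<open>curve_length\<close>. It gets a name
  because a real \<open>Sup\<close> is informative only for bounded sets, so its boundedness is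
  carried as a hypothesis.\<close>

abbreviation chord_sums :: "(real \<Rightarrow> 'a::metric_space) \<Rightarrow> real \<Rightarrow> real \<Rightarrow> real set" where
  "chord_sums g s t \<equiv> {\<Sum>i<n. dist (g (p (Suc i))) (g (p i)) | p n. is_partition p n s t}"

lemma chord_sumsI:
  "is_partition p n s t \<Longrightarrow> (\<Sum>i<n. dist (g (p (Suc i))) (g (p i))) \<in> chord_sums g s t"
  by blast

lemma is_partition_mono:
  assumes "is_partition p n s t" "i \<le> j" "j \<le> n"
  shows "p i \<le> p j"
  using assms(2,3)
proof (induction j rule: dec_induct)
  case (step k)
  then have "p i \<le> p k" "p k \<le> p (Suc k)"
    using assms(1) by (auto simp: is_partition_def)
  then show ?case by (rule order_trans)
qed simp

lemma is_partition_bounds: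
  assumes "is_partition p n s t" "i \<le> n"
  shows "s \<le> p i" "p i \<le> t"
  using is_partition_mono[OF assms(1), of 0 i] is_partition_mono[OF assms(1), of i n] assms
  by (auto simp: is_partition_def)

text \<open>Concatenate the two partitions: run through \<open>p\<close> up to index
  \<open>n\<close>, then through \<open>q\<close> shifted by \<open>n\<close>.\<close>

lemma chord_sums_add:
  assumes "A \<in> chord_sums g s t" "B \<in> chord_sums g t u"
  shows "A + B \<in> chord_sums g s u"
proof -
  obtain p n where p: "is_partition p n s t" and A: "A = (\<Sum>i<n. dist (g (p (Suc i))) (g (p i)))"
    using assms(1) by blast
  obtain q m where q: "is_partition q m t u" and B: "B = (\<Sum>i<m. dist (g (q (Suc i))) (g (q i)))"
    using assms(2) by blast
  define r where "r i = (if i \<le> n then p i else q (i - n))" for i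
  \<comment> \<open>At \<open>i = 0\<close> the definition of \<open>r\<close> uses the branch of
    \<open>p\<close>; the two branches agree there because \<open>p n = t = q 0\<close>.\<close>
  have r_add: "r (n + i) = q i" for i
    using p q by (cases i) (auto simp: r_def is_partition_def)
  have "r i \<le> r (Suc i)" if "i < n + m" for i
  proof (cases "i < n")
    case True
    then show ?thesis using p by (auto simp: r_def is_partition_def)
  next
    case False
    then have "i = n + (i - n)" "i - n < m" using that by auto
    then show ?thesis
      using q r_add[of "i - n"] r_add[of "Suc (i - n)"] by (auto simp: is_partition_def)
  qed
  moreover have "r 0 = s" "r (n + m) = u"
    using p q by (auto simp: r_def is_partition_def r_add)
  ultimately have r: "is_partition r (n + m) s u" by (simp add: is_partition_def)
  have split: "(\<Sum>i<n + k. f i) = (\<Sum>i<n. f i) + (\<Sum>i<k. f (n + i))" for f :: "nat \<Rightarrow> real" and k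
    by (induction k) auto
  have "(\<Sum>i<n + m. dist (g (r (Suc i))) (g (r i))) = A + B"
    unfolding split A B
  proof (intro arg_cong2[where f = "(+)"] sum.cong refl)
    show "dist (g (r (Suc i))) (g (r i)) = dist (g (p (Suc i))) (g (p i))" if "i \<in> {..<n}" for i
      using that by (simp add: r_def)
    show "dist (g (r (Suc (n + i)))) (g (r (n + i))) = dist (g (q (Suc i))) (g (q i))" for i
      using r_add[of i] r_add[of "Suc i"] by simp
  qed
  then show ?thesis using chord_sumsI[OF r, of g] by simp
qed

lemma dist_in_chord_sums:
  assumes "s \<le> t"
  shows "dist (g t) (g s) \<in> chord_sums g s t"
proof -
  have "is_partition (\<lambda>i. if i = 0 then s else t) 1 s t"
    using assms by (auto simp: is_partition_def)
  from chord_sumsI[OF this, of g] show ?thesis by simp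
qed

text \<open>A sum over the inner interval is completed by one chord on each side to a sum over the
  outer interval, and the added chords are nonnegative.\<close>

lemma bdd_above_chord_sums_mono:
  assumes "bdd_above (chord_sums g s u)" "s \<le> s'" "s' \<le> t'" "t' \<le> u"
  shows "bdd_above (chord_sums g s' t')"
proof -
  obtain B where B: "\<And>A. A \<in> chord_sums g s u \<Longrightarrow> A \<le> B"
    using assms(1) unfolding bdd_above_def by blast
  show ?thesis
  proof (rule bdd_aboveI)
    fix A assume "A \<in> chord_sums g s' t'"
    from chord_sums_add[OF dist_in_chord_sums[OF assms(2)] this]
    have "dist (g s') (g s) + A \<in> chord_sums g s t'" .
    from B[OF chord_sums_add[OF this dist_in_chord_sums[OF assms(4)]]]
    show "A \<le> B"
      using zero_le_dist[of "g s'" "g s"] zero_le_dist[of "g u" "g t'"] by linarith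
  qed
qed

lemma dist_le_curve_length:
  assumes "bdd_above (chord_sums g s t)" "s \<le> t"
  shows "dist (g t) (g s) \<le> curve_length g s t"
  unfolding curve_length_def by (rule cSup_upper[OF dist_in_chord_sums[OF assms(2)] assms(1)])

lemma curve_length_superadditive:
  assumes bdd: "bdd_above (chord_sums g s u)" and st: "s \<le> t" "t \<le> u"
  shows "curve_length g s t + curve_length g t u \<le> curve_length g s u"
proof -
  have ne: "chord_sums g s t \<noteq> {}" "chord_sums g t u \<noteq> {}"
    using dist_in_chord_sums st by blast+
  have le: "A + B \<le> curve_length g s u"
    if "A \<in> chord_sums g s t" "B \<in> chord_sums g t u" for A B
    unfolding curve_length_def using cSup_upper[OF chord_sums_add[OF that] bdd] .
  \<comment> \<open>The two suprema are taken one after the other: first over \<open>A\<close> for a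
    fixed \<open>B\<close>, then over \<open>B\<close>.\<close>
  have first: "curve_length g s t \<le> curve_length g s u - B" if "B \<in> chord_sums g t u" for B
    unfolding curve_length_def[of g s t]
  proof (rule cSup_least[OF ne(1)])
    show "A \<le> curve_length g s u - B" if "A \<in> chord_sums g s t" for A
      using le[OF that \<open>B \<in> chord_sums g t u\<close>] by linarith
  qed
  have "curve_length g t u \<le> curve_length g s u - curve_length g s t"
    unfolding curve_length_def[of g t u]
  proof (rule cSup_least[OF ne(2)])
    show "B \<le> curve_length g s u - curve_length g s t" if "B \<in> chord_sums g t u" for B
      using first[OF that] by linarith
  qed
  then show ?thesis by simp
qed

text \<open>By superadditivity each piece is at most the increment of
  \<open>curve_length g s\<close>, and the increments telescope.\<close>

lemma sum_curve_length_le: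
  assumes bdd: "bdd_above (chord_sums g s t)" and p: "is_partition p n s t"
  shows "(\<Sum>i<n. curve_length g (p i) (p (Suc i))) \<le> curve_length g s t"
proof -
  note bounds = is_partition_bounds[OF p]
  have st: "s \<le> t" using bounds[of 0] by linarith
  have "curve_length g (p i) (p (Suc i)) \<le> curve_length g s (p (Suc i)) - curve_length g s (p i)"
    if "i < n" for i
  proof -
    have "bdd_above (chord_sums g s (p (Suc i)))"
      by (rule bdd_above_chord_sums_mono[OF bdd]) (use that bounds[of "Suc i"] in auto)
    then show ?thesis
      using curve_length_superadditive[of g s "p (Suc i)" "p i"] bounds[of i] that p
      by (auto simp: is_partition_def)
  qed
  then have "(\<Sum>i<n. curve_length g (p i) (p (Suc i)))
      \<le> (\<Sum>i<n. curve_length g s (p (Suc i)) - curve_length g s (p i))"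
    by (intro sum_mono) auto
  also have "\<dots> = curve_length g s t - curve_length g s s"
    using p by (simp add: sum_lessThan_telescope[where f = "\<lambda>i. curve_length g s (p i)"] is_partition_def)
  also have "\<dots> \<le> curve_length g s t"
    using dist_le_curve_length[OF bdd_above_chord_sums_mono[OF bdd, of s s]] st by simp
  finally show ?thesis .
qed

section \<open>Estimates of arc-length integrals from both sides\<close>

abbreviation darboux_sums :: "('a::real_normed_vector \<Rightarrow> real) \<Rightarrow> (real \<Rightarrow> 'a) \<Rightarrow> real set" where
  "darboux_sums f g \<equiv> {\<Sum>i<n. (INF t\<in>{p i..p (Suc i)}. f (g t)) * curve_length g (p i) (p (Suc i)) | p n.
            is_partition p n 0 1}"

text \<open>On the compact image \<open>f\<close> has a bound \<open>B\<close>, so every sum is at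
  most \<open>B\<close> times the length. This makes the \<open>Sup\<close> in
  \<open>arclength_integral\<close> a true upper bound of its Darboux sums.\<close>

lemma bdd_above_darboux_sums:
  assumes g: "rectifiable_path g" and cont: "continuous_on (path_image g) f"
    and nonneg: "\<And>z. z \<in> path_image g \<Longrightarrow> 0 \<le> f z"
  shows "bdd_above (darboux_sums f g)"
proof -
  have bdd: "bdd_above (chord_sums g 0 1)" and "path g"
    using g by (auto simp: rectifiable_path_def)
  have "compact (f ` path_image g)"
    by (intro compact_continuous_image cont compact_path_image \<open>path g\<close>)
  then have "bdd_above (f ` path_image g)"
    by (intro bounded_imp_bdd_above compact_imp_bounded)
  then obtain B where B: "\<And>z. z \<in> path_image g \<Longrightarrow> f z \<le> B"
    by (auto simp: bdd_above_def)
  have "B \<ge> 0"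
    using B[of "g 0"] nonneg[of "g 0"] pathstart_in_path_image[of g] by (simp add: pathstart_def)
  show ?thesis
  proof (rule bdd_aboveI)
    fix S assume "S \<in> darboux_sums f g"
    then obtain p n where p: "is_partition p n 0 1"
      and S: "S = (\<Sum>i<n. (INF t\<in>{p i..p (Suc i)}. f (g t)) * curve_length g (p i) (p (Suc i)))"
      by blast
    note bounds = is_partition_bounds[OF p]
    have "S \<le> (\<Sum>i<n. B * curve_length g (p i) (p (Suc i)))"
      unfolding S
    proof (intro sum_mono mult_right_mono)
      fix i assume "i \<in> {..<n}"
      then have i: "p i \<le> p (Suc i)" "0 \<le> p i" "p (Suc i) \<le> 1"
        using p bounds[of i] bounds[of "Suc i"] by (auto simp: is_partition_def)
      then have im: "g t \<in> path_image g" if "t \<in> {p i..p (Suc i)}" for t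
        using that by (auto simp: path_image_def)
      have "(INF t\<in>{p i..p (Suc i)}. f (g t)) \<le> f (g (p i))"
        by (intro cINF_lower bdd_belowI[where m = 0]) (use i im nonneg in auto)
      also have "\<dots> \<le> B" using B im i by simp
      finally show "(INF t\<in>{p i..p (Suc i)}. f (g t)) \<le> B" .
      show "0 \<le> curve_length g (p i) (p (Suc i))"
        using dist_le_curve_length[OF bdd_above_chord_sums_mono[OF bdd]] i
        by (meson order_trans zero_le_dist)
    qed
    also have "\<dots> \<le> B * curve_length g 0 1"
      using sum_curve_length_le[OF bdd p] \<open>B \<ge> 0\<close>
      by (simp add: mult_left_mono flip: sum_distrib_left)
    finally show "S \<le> B * curve_length g 0 1" .
  qed
qed

text \<open>On a partition so fine that \<open>f\<close> along \<open>g\<close> oscillates by less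
  than \<open>e\<close> on each piece, the \<open>max\<close> in the assumption exceeds the infimum
  of the piece by at most \<open>e\<close>. The increments of \<open>F\<close> then add up to at
  most a Darboux sum plus \<open>e\<close> times the length.\<close>

lemma arclength_integral_ge_calibration:
  assumes g: "rectifiable_path g" and cont: "continuous_on (path_image g) f"
    and nonneg: "\<And>z. z \<in> path_image g \<Longrightarrow> 0 \<le> f z"
    and F: "\<And>z w. z \<in> path_image g \<Longrightarrow> w \<in> path_image g \<Longrightarrow> F z - F w \<le> dist z w * max (f z) (f w)"
  shows "F (pathfinish g) - F (pathstart g) \<le> arclength_integral f g"
proof -
  have bdd: "bdd_above (chord_sums g 0 1)" and "path g"
    using g by (auto simp: rectifiable_path_def)
  have im: "g t \<in> path_image g" if "t \<in> {0..1}" for t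
    using that by (auto simp: path_image_def)
  have "continuous_on {0..1} (\<lambda>t. f (g t))"
    using continuous_on_compose2[OF cont, of "{0..1}" g] \<open>path g\<close> by (auto simp: path_def path_image_def)
  then have unif: "uniformly_continuous_on {0..1} (\<lambda>t. f (g t))"
    by (simp add: compact_uniformly_continuous)
  define V where "V = curve_length g 0 1"
  have approx: "F (g 1) - F (g 0) \<le> arclength_integral f g + e * V" if "e > 0" for e
  proof -
    obtain d where "d > 0"
      and d: "\<And>t t'. t \<in> {0..1} \<Longrightarrow> t' \<in> {0..1} \<Longrightarrow> dist t' t < d \<Longrightarrow> dist (f (g t')) (f (g t)) < e"
      using unif \<open>e > 0\<close> unfolding uniformly_continuous_on_def by metis
    obtain n :: nat where "n > 0" and n: "1 / n < d"
      using \<open>d > 0\<close> by (metis nat_approx_posE of_nat_0_less_iff zero_less_Suc)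
    \<comment> \<open>The uniform partition, whose pieces have width
      \<open>1 / n < d\<close>.\<close>
    define p where "p i = real i / n" for i :: nat
    have p: "is_partition p n 0 1"
      using \<open>n > 0\<close> by (auto simp: is_partition_def p_def divide_right_mono)
    note bounds = is_partition_bounds[OF p]
    define I where "I i = (INF t\<in>{p i..p (Suc i)}. f (g t))" for i
    have step: "F (g (p (Suc i))) - F (g (p i))
        \<le> I i * curve_length g (p i) (p (Suc i)) + e * dist (g (p (Suc i))) (g (p i))"
      if "i < n" for i
    proof -
      have i: "p i \<le> p (Suc i)" "0 \<le> p i" "p (Suc i) \<le> 1"
        using that p bounds[of i] bounds[of "Suc i"] by (auto simp: is_partition_def)
      have width: "p (Suc i) - p i = 1 / n" by (simp add: p_def add_divide_distrib)
      have osc: "f (g t) - e \<le> I i" if "t \<in> {p i..p (Suc i)}" for t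
        unfolding I_def
      proof (rule cINF_greatest)
        fix t' assume t': "t' \<in> {p i..p (Suc i)}"
        then have "dist t' t < d" using that width n by (auto simp: dist_real_def)
        then show "f (g t) - e \<le> f (g t')"
          using d[of t t'] that t' i by (auto simp: dist_real_def)
      qed (use i in auto)
      have "0 \<le> I i"
        unfolding I_def by (rule cINF_greatest) (use i im nonneg in auto)
      have "F (g (p (Suc i))) - F (g (p i))
          \<le> dist (g (p (Suc i))) (g (p i)) * max (f (g (p (Suc i)))) (f (g (p i)))"
        using F im i by auto
      also have "\<dots> \<le> dist (g (p (Suc i))) (g (p i)) * (I i + e)"
        using osc[of "p i"] osc[of "p (Suc i)"] i by (intro mult_left_mono) auto
      also have "\<dots> = I i * dist (g (p (Suc i))) (g (p i)) + e * dist (g (p (Suc i))) (g (p i))"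
        by (simp add: algebra_simps)
      also have "I i * dist (g (p (Suc i))) (g (p i)) \<le> I i * curve_length g (p i) (p (Suc i))"
        using dist_le_curve_length[OF bdd_above_chord_sums_mono[OF bdd]] i \<open>0 \<le> I i\<close>
        by (intro mult_left_mono) auto
      finally show ?thesis by simp
    qed
    have "F (g 1) - F (g 0) = (\<Sum>i<n. F (g (p (Suc i))) - F (g (p i)))"
      using p by (simp add: sum_lessThan_telescope[where f = "\<lambda>i. F (g (p i))"] is_partition_def)
    also have "\<dots> \<le> (\<Sum>i<n. I i * curve_length g (p i) (p (Suc i)) + e * dist (g (p (Suc i))) (g (p i)))"
      using step by (intro sum_mono) auto
    also have "\<dots> = (\<Sum>i<n. I i * curve_length g (p i) (p (Suc i)))
        + e * (\<Sum>i<n. dist (g (p (Suc i))) (g (p i)))"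
      by (simp add: sum.distrib sum_distrib_left)
    also have "(\<Sum>i<n. I i * curve_length g (p i) (p (Suc i))) \<le> arclength_integral f g"
      unfolding arclength_integral_def I_def
      by (rule cSup_upper[OF _ bdd_above_darboux_sums[OF g cont nonneg]]) (use p in auto)
    also have "(\<Sum>i<n. dist (g (p (Suc i))) (g (p i))) \<le> V"
      unfolding V_def curve_length_def by (rule cSup_upper[OF _ bdd]) (use p in auto)
    finally show ?thesis using \<open>e > 0\<close> by simp
  qed
  have "V \<ge> 0"
    using dist_le_curve_length[OF bdd] unfolding V_def by (meson order_trans zero_le_dist zero_le_one)
  have "F (g 1) - F (g 0) \<le> arclength_integral f g"
  proof (rule field_le_epsilon)
    fix e :: real assume "e > 0"
    \<comment> \<open>The denominator is \<open>V + 1\<close> because the length \<open>V\<close> of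
      a constant path is 0.\<close>
    then have "e / (V + 1) * V \<le> e" using \<open>V \<ge> 0\<close> by (simp add: field_simps)
    then show "F (g 1) - F (g 0) \<le> arclength_integral f g + e"
      using approx[of "e / (V + 1)"] \<open>e > 0\<close> \<open>V \<ge> 0\<close> by simp
  qed
  then show ?thesis by (simp add: pathfinish_def pathstart_def)
qed

text \<open>The function \<open>h\<close> plays the role of the integral up to time
  \<open>t\<close>: its increments dominate \<open>k\<close> times a chord for every lower bound
  \<open>k\<close> of \<open>f\<close> on the piece. Summing over chords and taking \<open>k\<close>
  as the infimum dominates each Darboux term. The positive bound \<open>m\<close> gives
  rectifiability and permits division by \<open>k\<close>.\<close>

lemma arclength_integral_le:
  assumes "path g" and "m > 0" and m: "\<And>t. t \<in> {0..1} \<Longrightarrow> m \<le> f (g t)"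
    and h: "\<And>s t k. 0 \<le> s \<Longrightarrow> s \<le> t \<Longrightarrow> t \<le> 1 \<Longrightarrow> 0 \<le> k \<Longrightarrow> (\<And>r. r \<in> {s..t} \<Longrightarrow> k \<le> f (g r)) \<Longrightarrow>
        k * dist (g t) (g s) \<le> h t - h s"
  shows "rectifiable_path g" and "arclength_integral f g \<le> h 1 - h 0"
proof -
  \<comment> \<open>A lower bound \<open>k\<close> on the whole interval is one on every
    subinterval, so the assumption on \<open>h\<close> can be summed along a partition.\<close>
  have chords: "k * S \<le> h t - h s"
    if "0 \<le> s" "s \<le> t" "t \<le> 1" "0 \<le> k" "\<And>r. r \<in> {s..t} \<Longrightarrow> k \<le> f (g r)" "S \<in> chord_sums g s t"
    for s t k S
  proof -
    obtain p n where p: "is_partition p n s t" and S: "S = (\<Sum>i<n. dist (g (p (Suc i))) (g (p i)))"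
      using \<open>S \<in> chord_sums g s t\<close> by blast
    note bounds = is_partition_bounds[OF p]
    have "k * S = (\<Sum>i<n. k * dist (g (p (Suc i))) (g (p i)))"
      by (simp add: S sum_distrib_left)
    also have "\<dots> \<le> (\<Sum>i<n. h (p (Suc i)) - h (p i))"
    proof (intro sum_mono h that(4,5))
      fix i assume i: "i \<in> {..<n}"
      then show "p i \<le> p (Suc i)" using p by (simp add: is_partition_def)
      show "0 \<le> p i" "p (Suc i) \<le> 1"
        using bounds[of i] bounds[of "Suc i"] i that(1,3) by auto
      show "r \<in> {s..t}" if "r \<in> {p i..p (Suc i)}" for r
        using bounds[of i] bounds[of "Suc i"] i that by auto
    qed
    also have "\<dots> = h t - h s"
      using p by (simp add: sum_lessThan_telescope[where f = "\<lambda>i. h (p i)"] is_partition_def)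
    finally show ?thesis .
  qed
  have "S \<le> (h 1 - h 0) / m" if "S \<in> chord_sums g 0 1" for S
    using chords[OF _ _ _ _ _ that, of m] m \<open>m > 0\<close> by (simp add: field_simps)
  then show "rectifiable_path g"
    using \<open>path g\<close> unfolding rectifiable_path_def bdd_above_def by blast
  show "arclength_integral f g \<le> h 1 - h 0"
    unfolding arclength_integral_def
  proof (rule cSup_least)
    have "is_partition real 1 0 1" by (simp add: is_partition_def)
    then show "darboux_sums f g \<noteq> {}" by blast
  next
    fix S assume "S \<in> darboux_sums f g"
    then obtain p n where p: "is_partition p n 0 1"
      and S: "S = (\<Sum>i<n. (INF t\<in>{p i..p (Suc i)}. f (g t)) * curve_length g (p i) (p (Suc i)))"
      by blast
    note bounds = is_partition_bounds[OF p]
    have "S \<le> (\<Sum>i<n. h (p (Suc i)) - h (p i))"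
      unfolding S
    proof (rule sum_mono)
      fix i assume "i \<in> {..<n}"
      then have i: "p i \<le> p (Suc i)" "0 \<le> p i" "p (Suc i) \<le> 1"
        using p bounds[of i] bounds[of "Suc i"] by (auto simp: is_partition_def)
      define k where "k = (INF t\<in>{p i..p (Suc i)}. f (g t))"
      have "m \<le> k"
        unfolding k_def by (rule cINF_greatest) (use i m in auto)
      then have "k > 0" using \<open>m > 0\<close> by simp
      have k: "k \<le> f (g r)" if "r \<in> {p i..p (Suc i)}" for r
        unfolding k_def by (intro cINF_lower that bdd_belowI[where m = m]) (use i m in auto)
      have "curve_length g (p i) (p (Suc i)) \<le> (h (p (Suc i)) - h (p i)) / k"
        unfolding curve_length_def
      proof (rule cSup_least)
        show "chord_sums g (p i) (p (Suc i)) \<noteq> {}" using dist_in_chord_sums[OF i(1)] by blast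
        show "A \<le> (h (p (Suc i)) - h (p i)) / k" if "A \<in> chord_sums g (p i) (p (Suc i))" for A
          using chords[OF i(2,1,3) _ k that] \<open>k > 0\<close> by (simp add: field_simps)
      qed
      then show "(INF t\<in>{p i..p (Suc i)}. f (g t)) * curve_length g (p i) (p (Suc i)) \<le> h (p (Suc i)) - h (p i)"
        using \<open>k > 0\<close> by (simp add: field_simps flip: k_def)
    qed
    also have "\<dots> = h 1 - h 0"
      using p by (simp add: sum_lessThan_telescope[where f = "\<lambda>i. h (p i)"] is_partition_def)
    finally show "S \<le> h 1 - h 0" .
  qed
qed

section \<open>Quasihyperbolic distance\<close>

text \<open>A segment from \<open>w\<close> to a point outside \<open>G\<close> meets the frontier,
  at a point no farther from \<open>w\<close> than the end of the segment.\<close>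

lemma ball_bdist_subset:
  assumes "w \<in> G"
  shows "ball w (bdist G w) \<subseteq> G"
proof
  fix z assume z: "z \<in> ball w (bdist G w)"
  show "z \<in> G"
  proof (rule ccontr)
    assume "z \<notin> G"
    then have "closed_segment w z \<inter> frontier G \<noteq> {}"
      using assms by (intro connected_Int_frontier) (auto intro: connected_segment)
    then obtain q where q: "q \<in> closed_segment w z" "q \<in> frontier G" by blast
    then have "bdist G w \<le> dist w q" by (simp add: bdist_def infdist_le)
    also have "\<dots> \<le> dist w z"
      using q segment_bound(1)[of q w z] by (simp add: dist_norm norm_minus_commute)
    finally show False using z by simp
  qed
qed

text \<open>An open set is disjoint from its frontier, so the ball contains no frontier point. The
  nonempty frontier excludes the default value 0 of \<open>infdist\<close> at the empty set.\<close>

lemma bdist_geI: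
  assumes "open G" "frontier G \<noteq> {}" "ball w r \<subseteq> G"
  shows "r \<le> bdist G w"
proof -
  have "r \<le> (INF q\<in>frontier G. dist w q)"
  proof (rule cINF_greatest[OF assms(2)])
    fix q assume "q \<in> frontier G"
    then have "q \<notin> ball w r" using assms(1,3) by (auto simp: frontier_def interior_open)
    then show "r \<le> dist w q" by simp
  qed
  then show ?thesis using assms(2) by (simp add: bdist_def infdist_def)
qed

lemma bdist_pos:
  assumes "open G" "frontier G \<noteq> {}" "w \<in> G"
  shows "0 < bdist G w"
proof -
  obtain e where "e > 0" "ball w e \<subseteq> G" using assms openE by blast
  then show ?thesis using bdist_geI[OF assms(1,2)] by fastforce
qed

lemma continuous_on_inverse_bdist:
  assumes "open G" "frontier G \<noteq> {}"
  shows "continuous_on G (\<lambda>z. 1 / bdist G z)"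
proof -
  have "continuous_on G (bdist G)"
    unfolding bdist_def by (intro continuous_intros)
  then show ?thesis
    using bdist_pos[OF assms] by (intro continuous_intros) (auto simp: less_imp_neq[THEN not_sym])
qed

text \<open>The calibration bound holds for each competing curve. The curve \<gamma> shows that
  there is one, so that the infimum is over a nonempty set.\<close>

lemma qh_dist_ge_calibration:
  assumes G: "open G" "frontier G \<noteq> {}"
    and ex: "rectifiable_path \<gamma>" "path_image \<gamma> \<subseteq> G" "pathstart \<gamma> = x" "pathfinish \<gamma> = y"
    and F: "\<And>z w. z \<in> G \<Longrightarrow> w \<in> G \<Longrightarrow> F z - F w \<le> dist z w * max (1 / bdist G z) (1 / bdist G w)"
  shows "F y - F x \<le> qh_dist G x y"
  unfolding qh_dist_def
proof (rule cInf_greatest)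
  show "{arclength_integral (\<lambda>z. 1 / bdist G z) g | g.
       rectifiable_path g \<and> path_image g \<subseteq> G \<and> pathstart g = x \<and> pathfinish g = y} \<noteq> {}"
    using ex by blast
next
  fix l assume "l \<in> {arclength_integral (\<lambda>z. 1 / bdist G z) g | g.
       rectifiable_path g \<and> path_image g \<subseteq> G \<and> pathstart g = x \<and> pathfinish g = y}"
  then obtain g where g: "rectifiable_path g" "path_image g \<subseteq> G" "pathstart g = x" "pathfinish g = y"
    and l: "l = arclength_integral (\<lambda>z. 1 / bdist G z) g" by blast
  have "F (pathfinish g) - F (pathstart g) \<le> arclength_integral (\<lambda>z. 1 / bdist G z) g"
  proof (rule arclength_integral_ge_calibration[OF g(1)])
    show "continuous_on (path_image g) (\<lambda>z. 1 / bdist G z)"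
      by (rule continuous_on_subset[OF continuous_on_inverse_bdist[OF G] g(2)])
    show "0 \<le> 1 / bdist G z" if "z \<in> path_image g" for z
      using bdist_pos[OF G, of z] that g(2) by auto
  qed (use F g(2) in blast)
  then show "F y - F x \<le> l" using g l by simp
qed

lemma qh_dist_le:
  assumes G: "open G" "frontier G \<noteq> {}"
    and g: "rectifiable_path g" "path_image g \<subseteq> G" "pathstart g = x" "pathfinish g = y"
  shows "qh_dist G x y \<le> arclength_integral (\<lambda>z. 1 / bdist G z) g"
  unfolding qh_dist_def
proof (rule cInf_lower)
  show "bdd_below {arclength_integral (\<lambda>z. 1 / bdist G z) g | g.
       rectifiable_path g \<and> path_image g \<subseteq> G \<and> pathstart g = x \<and> pathfinish g = y}"
  proof (rule bdd_belowI[where m = 0], clarify)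
    fix \<gamma> assume \<gamma>: "rectifiable_path \<gamma>" "path_image \<gamma> \<subseteq> G"
    have pos: "0 < bdist G z" if "z \<in> path_image \<gamma>" for z
      using bdist_pos[OF G] that \<gamma>(2) by blast
    \<comment> \<open>The constant calibration 0 shows that these integrals are nonnegative.\<close>
    show "0 \<le> arclength_integral (\<lambda>z. 1 / bdist G z) \<gamma>"
      using arclength_integral_ge_calibration[OF \<gamma>(1), where f = "\<lambda>z. 1 / bdist G z" and F = "\<lambda>_. 0"]
        continuous_on_subset[OF continuous_on_inverse_bdist[OF G] \<gamma>(2)] pos
      by (simp add: less_imp_le max_def)
  qed
qed (use g in blast)

section \<open>Hyperbolic geodesics of the unit disc\<close>

text \<open>Concavity of \<open>ln\<close>: the point \<open>1 + s\<close> divides the segment from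
  1 to \<open>1 + c * s\<close> with weight \<open>1 / c\<close>. This is Bernoulli's inequality in
  logarithmic form.\<close>

lemma ln_one_plus_mult_le:
  fixes c s :: real
  assumes "1 \<le> c" "0 \<le> s"
  shows "ln (1 + c * s) \<le> c * ln (1 + s)"
proof -
  have "(1 - 1 / c) * ln 1 + 1 / c * ln (1 + c * s) \<le> ln ((1 - 1 / c) *\<^sub>R 1 + (1 / c) *\<^sub>R (1 + c * s))"
    using assms by (intro concave_onD[OF ln_concave]) (auto intro: add_pos_nonneg)
  also have "(1 - 1 / c) *\<^sub>R 1 + (1 / c) *\<^sub>R (1 + c * s) = 1 + s"
    using assms by (simp add: field_simps)
  finally show ?thesis using assms by (simp add: field_simps)
qed

lemma moebius_identity:
  fixes x y :: complex
  shows "(norm (1 - cnj x * y))\<^sup>2 = (norm (x - y))\<^sup>2 + (1 - (norm x)\<^sup>2) * (1 - (norm y)\<^sup>2)"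
  unfolding cmod_power2 by (simp add: power2_eq_square algebra_simps)

text \<open>Here \<open>r\<close> is the pseudo-hyperbolic distance and
  \<open>ln (1 + r) - ln (1 - r)\<close> the hyperbolic distance. With \<open>D\<close>,
  \<open>N\<close>, \<open>q\<close> as below, \<open>N\<^sup>2 - D\<^sup>2 = q\<^sup>2\<close>
  turns \<open>(1 + r) / (1 - r)\<close> into the square of \<open>(N + D) / q\<close>. It remains
  to see \<open>(N + D) / q \<le> 1 + D / d\<close>, which is proved by squaring.\<close>

lemma hyperbolic_dist_le_j:
  fixes x y :: complex
  assumes xy: "norm x < 1" "norm y < 1"
  defines "r \<equiv> norm (x - y) / norm (1 - cnj x * y)"
  shows "r < 1" and "ln (1 + r) - ln (1 - r) \<le> 2 * ln (1 + norm (x - y) / min (1 - norm x) (1 - norm y))"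
proof -
  define D where "D = norm (x - y)"
  define N where "N = norm (1 - cnj x * y)"
  define P where "P = (1 - (norm x)\<^sup>2) * (1 - (norm y)\<^sup>2)"
  define d where "d = min (1 - norm x) (1 - norm y)"
  have sq: "(norm x)\<^sup>2 < 1" "(norm y)\<^sup>2 < 1"
    using xy by (auto simp: power_less_one_iff)
  then have "P > 0" by (simp add: P_def)
  have N2: "N\<^sup>2 = D\<^sup>2 + P" using moebius_identity[of x y] by (simp add: N_def D_def P_def)
  have D: "0 \<le> D" by (simp add: D_def)
  have "0 \<le> N" by (simp add: N_def)
  have "D < N" using N2 \<open>P > 0\<close> \<open>0 \<le> N\<close> D by (intro power2_less_imp_less[of D N]) auto
  then show "r < 1" using D by (simp add: r_def flip: D_def N_def)
  have r: "r = D / N" "0 \<le> r" "r < 1" using \<open>r < 1\<close> by (auto simp: r_def D_def N_def)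
  have "d > 0" "d \<le> 1" using xy by (auto simp: d_def min_def)
  have D2: "D \<le> 2 * (1 - d)"
    using norm_triangle_ineq4[of x y] by (auto simp: D_def d_def min_def)
  \<comment> \<open>Both moduli are at most \<open>1 - d\<close>, and
    \<open>1 - (1 - d)\<^sup>2 = d * (2 - d)\<close>.\<close>
  have Pd: "d\<^sup>2 * (2 - d)\<^sup>2 \<le> P"
  proof -
    have "d * (2 - d) \<le> 1 - t\<^sup>2" if "0 \<le> t" "t \<le> 1 - d" for t :: real
      using power_mono[OF that(2,1), of 2] by (simp add: power2_eq_square algebra_simps)
    then have "d * (2 - d) \<le> 1 - (norm x)\<^sup>2" "d * (2 - d) \<le> 1 - (norm y)\<^sup>2"
      by (auto simp: d_def min_def)
    then have "(d * (2 - d)) * (d * (2 - d)) \<le> P"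
      unfolding P_def using \<open>d > 0\<close> \<open>d \<le> 1\<close> sq by (intro mult_mono) auto
    then show ?thesis by (simp add: power2_eq_square algebra_simps)
  qed
  define q where "q = sqrt P"
  have q: "q > 0" "q\<^sup>2 = P" using \<open>P > 0\<close> by (auto simp: q_def)
  have qd: "d * (2 - d) \<le> q"
  proof (rule power2_le_imp_le)
    show "(d * (2 - d))\<^sup>2 \<le> q\<^sup>2" unfolding q(2) power_mult_distrib by (rule Pd)
  qed (use q in simp)
  have "N \<le> q + q * D / d - D"
  proof (rule power2_le_imp_le)
    have "D * d \<le> q * D"
    proof -
      have "d \<le> d * (2 - d)" using \<open>d > 0\<close> \<open>d \<le> 1\<close> by (simp add: algebra_simps)
      then show ?thesis using qd D by (simp add: mult.commute mult_left_mono)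
    qed
    then have "D \<le> q * D / d" using \<open>d > 0\<close> by (simp add: field_simps)
    then show "0 \<le> q + q * D / d - D" using q(1) by linarith
    \<comment> \<open>Up to the factor \<open>1 / d\<^sup>2\<close> this product is the difference
      of the two squares to be compared.\<close>
    have "0 \<le> D * (2 * q * (q - d) * d + q\<^sup>2 * D - 2 * q * D * d)"
    proof (intro mult_nonneg_nonneg D)
      have "2 * q * (q - d) * d + q\<^sup>2 * D - 2 * q * D * d = q * (2 * (q - d) * d - D * (2 * d - q))"
        by (simp add: power2_eq_square algebra_simps)
      also have "0 \<le> \<dots>"
      proof (intro mult_nonneg_nonneg)
        show "0 \<le> 2 * (q - d) * d - D * (2 * d - q)"
        proof (cases "2 * d \<le> q")
          case True
          then have "D * (2 * d - q) \<le> 0" using D by (simp add: mult_nonneg_nonpos)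
          moreover have "0 \<le> 2 * (q - d) * d" using True \<open>d > 0\<close> by simp
          ultimately show ?thesis by linarith
        next
          case False
          \<comment> \<open>For \<open>q < 2 * d\<close> the expression decreases in
            \<open>D\<close>; at the largest value \<open>D = 2 * (1 - d)\<close> it equals
            \<open>2 * (q - d * (2 - d))\<close>, which \<open>qd\<close> makes nonnegative.\<close>
          then have *: "D * (2 * d - q) \<le> 2 * (1 - d) * (2 * d - q)"
            using D2 by (intro mult_right_mono) auto
          have "0 \<le> 2 * (q - d * (2 - d))" using qd by simp
          also have "\<dots> = 2 * (q - d) * d - 2 * (1 - d) * (2 * d - q)"
            by (simp add: algebra_simps)
          also have "\<dots> \<le> 2 * (q - d) * d - D * (2 * d - q)"
            using * by (rule diff_left_mono)
          finally show ?thesis .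
        qed
      qed (use q in auto)
      finally show "0 \<le> 2 * q * (q - d) * d + q\<^sup>2 * D - 2 * q * D * d" .
    qed
    then have "0 \<le> D * (2 * q * (q - d) * d + q\<^sup>2 * D - 2 * q * D * d) / d\<^sup>2"
      by simp
    also have "\<dots> = (q + q * D / d - D)\<^sup>2 - (D\<^sup>2 + q\<^sup>2)"
      using \<open>d > 0\<close> by (simp add: field_simps power2_eq_square)
    finally show "N\<^sup>2 \<le> (q + q * D / d - D)\<^sup>2" using N2 q by simp
  qed
  then have "(N + D) / q \<le> 1 + D / d"
    using q(1) by (simp add: field_simps)
  have "ln (1 + r) - ln (1 - r) = ln ((1 + r) / (1 - r))"
    using r(2,3) by (simp add: ln_div)
  also have "(1 + r) / (1 - r) = (N + D) / (N - D)"
    using r \<open>D < N\<close> D by (simp add: field_simps)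
  also have "\<dots> = ((N + D) / q)\<^sup>2"
  proof -
    have "q\<^sup>2 = (N + D) * (N - D)" using N2 q by (simp add: power2_eq_square algebra_simps)
    then show ?thesis using \<open>D < N\<close> D by (simp add: power_divide power2_eq_square)
  qed
  also have "ln \<dots> = 2 * ln ((N + D) / q)"
    using \<open>D < N\<close> D q by (simp add: ln_realpow)
  also have "\<dots> \<le> 2 * ln (1 + D / d)"
    using \<open>(N + D) / q \<le> 1 + D / d\<close> \<open>D < N\<close> D q(1) by (intro mult_left_mono ln_mono) auto
  finally show "ln (1 + r) - ln (1 - r) \<le> 2 * ln (1 + norm (x - y) / min (1 - norm x) (1 - norm y))"
    by (simp add: D_def d_def)
qed

text \<open>The disc automorphism \<open>T\<close> sends 0 to \<open>x\<close> and \<open>w\<close>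
  to \<open>y\<close>, hence the radius from 0 to \<open>w\<close> to the hyperbolic geodesic from
  \<open>x\<close> to \<open>y\<close>. Since \<open>T\<close> preserves the density
  \<open>1 / (1 - |z|\<^sup>2)\<close>, the speed of \<open>g\<close> in it is that of the
  radius.\<close>

lemma moebius_ray:
  fixes x y :: complex
  assumes xy: "norm x < 1" "norm y < 1"
  defines "r \<equiv> norm (x - y) / norm (1 - cnj x * y)"
  obtains g g' :: "real \<Rightarrow> complex"
  where "g 0 = x" "g 1 = y" "\<And>t. t \<in> {0..1} \<Longrightarrow> norm (g t) < 1"
    "\<And>t. t \<in> {0..1} \<Longrightarrow> (g has_vector_derivative g' t) (at t)"
    "\<And>t. t \<in> {0..1} \<Longrightarrow> norm (g' t) / (1 - (norm (g t))\<^sup>2) = r / (1 - (t * r)\<^sup>2)"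
proof -
  have "r < 1" unfolding r_def by (rule hyperbolic_dist_le_j(1)[OF xy])
  have ne: "1 + cnj x * z \<noteq> 0" if "norm z < 1" for z
  proof
    assume "1 + cnj x * z = 0"
    then have "norm (cnj x * z) = 1" by (metis add_eq_0_iff norm_minus_cancel norm_one)
    moreover have "norm x * norm z < 1 * 1" using xy that by (intro mult_strict_mono') auto
    ultimately show False by (simp add: norm_mult)
  qed
  have ne_y: "1 - cnj x * y \<noteq> 0" using ne[of "- y"] xy by simp
  define w where "w = (y - x) / (1 - cnj x * y)"
  have norm_w: "norm w = r" by (simp add: w_def r_def norm_divide norm_minus_commute)
  define T where "T z = (z + x) / (1 + cnj x * z)" for z
  have ray: "norm (of_real t * w) < 1" if "t \<in> {0..1}" for t
  proof -
    have "t * r \<le> r" using that norm_w[symmetric] by (simp add: mult_left_le_one_le)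
    then show ?thesis using that \<open>r < 1\<close> by (simp add: norm_mult norm_w)
  qed
  have x2: "(norm x)\<^sup>2 < 1" using xy by (simp add: power_less_one_iff)
  have xx: "(complex_of_real (norm x))\<^sup>2 = x * cnj x"
    using complex_norm_square[of x] by simp
  \<comment> \<open>The identity at \<open>- z\<close> in place of \<open>y\<close>, divided by the
    squared denominator of \<open>T\<close>.\<close>
  have T_norm: "1 - (norm (T z))\<^sup>2 = (1 - (norm x)\<^sup>2) * (1 - (norm z)\<^sup>2) / (norm (1 + cnj x * z))\<^sup>2"
    if "norm z < 1" for z
    using moebius_identity[of x "- z"] ne[OF that]
    by (simp add: T_def norm_divide power_divide field_simps)
  define g where "g t = T (of_real t * w)" for t
  define g' where "g' t = w * (of_real (1 - (norm x)\<^sup>2) / (1 + cnj x * (of_real t * w))\<^sup>2)" for t :: real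
  show thesis
  proof
    show "g 0 = x" by (simp add: g_def T_def)
    have den: "1 + cnj x * w = of_real (1 - (norm x)\<^sup>2) / (1 - cnj x * y)"
      using ne_y by (simp add: w_def field_simps xx)
    have "w + x = y * of_real (1 - (norm x)\<^sup>2) / (1 - cnj x * y)"
      using ne_y by (simp add: w_def field_simps xx)
    then show "g 1 = y" using den ne_y x2 by (simp add: g_def T_def flip: of_real_power)
    show "norm (g t) < 1" if "t \<in> {0..1}" for t
    proof -
      have "0 < 1 - (norm (g t))\<^sup>2"
        unfolding g_def T_norm[OF ray[OF that]]
        using x2 ray[OF that] ne[OF ray[OF that]] by (intro divide_pos_pos mult_pos_pos) (auto simp: power_less_one_iff abs_square_less_1)
      then show ?thesis by (simp add: abs_square_less_1 power_less_one_iff)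
    qed
    show "(g has_vector_derivative g' t) (at t)" if "t \<in> {0..1}" for t
    proof -
      have T': "(T has_field_derivative of_real (1 - (norm x)\<^sup>2) / (1 + cnj x * (of_real t * w))\<^sup>2) (at (of_real t * w))"
        unfolding T_def using ne[OF ray[OF that]]
        by (auto intro!: derivative_eq_intros simp: power2_eq_square xx[unfolded power2_eq_square] field_simps)
      have "((\<lambda>t. of_real t * w) has_vector_derivative w) (at t)"
        by (auto intro!: derivative_eq_intros has_vector_derivative_real_field)
      from field_vector_diff_chain_at[OF this T'] show ?thesis
        by (simp only: g_def[abs_def] g'_def o_def)
    qed
    show "norm (g' t) / (1 - (norm (g t))\<^sup>2) = r / (1 - (t * r)\<^sup>2)" if "t \<in> {0..1}" for t
    proof -
      have "norm (complex_of_real (1 - (norm x)\<^sup>2)) = 1 - (norm x)\<^sup>2"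
        unfolding norm_of_real using x2 by simp
      then have "norm (g' t) = r * ((1 - (norm x)\<^sup>2) / (norm (1 + cnj x * (of_real t * w)))\<^sup>2)"
        unfolding g'_def by (simp only: norm_divide norm_mult norm_power norm_w)
      moreover have "(norm (of_real t * w))\<^sup>2 = (t * r)\<^sup>2"
        by (simp add: norm_mult norm_w power_mult_distrib)
      ultimately show ?thesis
        unfolding g_def T_norm[OF ray[OF that]] using x2 ne[OF ray[OF that]] by simp
    qed
  qed
qed

section \<open>The ellipse\<close>

locale ellipse =
  fixes p u v :: "real^2" and a b :: real
  assumes b_pos: "0 < b" and b_le_a: "b \<le> a"
    and norm_u: "norm u = 1" and norm_v: "norm v = 1" and orth: "u \<bullet> v = 0"
begin

section \<open>Coordinates and the affine map of the disc\<close>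

definition X :: "real^2 \<Rightarrow> real" where "X w = (w - p) \<bullet> u"
definition Y :: "real^2 \<Rightarrow> real" where "Y w = (w - p) \<bullet> v"
definition pt :: "real \<Rightarrow> real \<Rightarrow> real^2" where "pt s t = p + s *\<^sub>R u + t *\<^sub>R v"
definition E :: "(real^2) set" where "E = {z. (X z)\<^sup>2 / a\<^sup>2 + (Y z)\<^sup>2 / b\<^sup>2 < 1}"
text \<open>The affine map of the unit disc onto the ellipse. Its source is \<open>complex\<close>,
  where the Moebius maps are available.\<close>

definition L :: "complex \<Rightarrow> real^2" where "L z = pt (a * Re z) (b * Im z)"

lemma a_pos: "0 < a"
  using b_pos b_le_a by simp

lemma inner_uv: "u \<bullet> u = 1" "v \<bullet> v = 1" "u \<bullet> v = 0" "v \<bullet> u = 0"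
  using norm_u norm_v orth by (auto simp: norm_eq_1 inner_commute)

lemma X_pt [simp]: "X (pt s t) = s" and Y_pt [simp]: "Y (pt s t) = t"
  by (simp_all add: X_def Y_def pt_def inner_uv inner_add_left)

text \<open>Two orthogonal nonzero vectors are independent, so by dimension \<open>u\<close> and
  \<open>v\<close> span the plane.\<close>

lemma pt_X_Y [simp]: "pt (X w) (Y w) = w"
proof -
  have "u \<noteq> v" using inner_uv by auto
  have "0 \<notin> {u, v}" using norm_u norm_v by auto
  then have "independent {u, v}"
    using inner_uv by (intro pairwise_orthogonal_independent) (auto simp: pairwise_def orthogonal_def)
  then have "span {u, v} = UNIV"
    using \<open>u \<noteq> v\<close> card_ge_dim_independent[of "{u, v}" UNIV] by auto
  then have "w - p \<in> span {u, v}" by simp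
  then obtain s where "w - p - s *\<^sub>R u \<in> span {v}"
    using span_breakdown_eq[of "w - p" u "{v}"] by blast
  then obtain t where "w - p - s *\<^sub>R u = t *\<^sub>R v"
    by (auto simp: span_singleton)
  then have "w = pt s t" by (simp add: pt_def algebra_simps)
  then show ?thesis by simp
qed

lemma dist_pt: "dist (pt s t) (pt s' t') = sqrt ((s - s')\<^sup>2 + (t - t')\<^sup>2)"
proof -
  have "pt s t - pt s' t' = (s - s') *\<^sub>R u + (t - t') *\<^sub>R v"
    by (simp add: pt_def algebra_simps)
  then show ?thesis
    by (simp add: dist_norm norm_eq_sqrt_inner inner_uv inner_add_left inner_add_right power2_eq_square)
qed

lemma L_surj: obtains z where "w = L z"
proof
  show "w = L (Complex (X w / a) (Y w / b))"
    using a_pos b_pos by (simp add: L_def)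
qed

lemma L_in_E_iff: "L z \<in> E \<longleftrightarrow> norm z < 1"
proof -
  have "L z \<in> E \<longleftrightarrow> (norm z)\<^sup>2 < 1"
    using a_pos b_pos by (simp add: E_def L_def cmod_power2 power_mult_distrib)
  then show ?thesis by (simp add: abs_square_less_1)
qed

lemma dist_L_le: "dist (L z) (L z') \<le> a * dist z z'"
proof -
  have "(a * Re z - a * Re z')\<^sup>2 + (b * Im z - b * Im z')\<^sup>2
      = a\<^sup>2 * (Re z - Re z')\<^sup>2 + b\<^sup>2 * (Im z - Im z')\<^sup>2"
    by (simp add: power2_eq_square algebra_simps)
  also have "\<dots> \<le> a\<^sup>2 * (Re z - Re z')\<^sup>2 + a\<^sup>2 * (Im z - Im z')\<^sup>2"
    using b_pos b_le_a by (intro add_left_mono mult_right_mono power_mono) auto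
  also have "\<dots> = (a * dist z z')\<^sup>2"
    by (simp add: dist_norm power_mult_distrib cmod_power2 algebra_simps)
  finally show ?thesis
    using a_pos by (simp add: L_def dist_pt real_le_lsqrt)
qed

lemma dist_L_ge: "b * dist z z' \<le> dist (L z) (L z')"
proof -
  have "(b * dist z z')\<^sup>2 = b\<^sup>2 * (Re z - Re z')\<^sup>2 + b\<^sup>2 * (Im z - Im z')\<^sup>2"
    by (simp add: dist_norm power_mult_distrib cmod_power2 algebra_simps)
  also have "\<dots> \<le> a\<^sup>2 * (Re z - Re z')\<^sup>2 + b\<^sup>2 * (Im z - Im z')\<^sup>2"
    using b_pos b_le_a by (intro add_right_mono mult_right_mono power_mono) auto
  also have "\<dots> = (a * Re z - a * Re z')\<^sup>2 + (b * Im z - b * Im z')\<^sup>2"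
    by (simp add: power2_eq_square algebra_simps)
  finally show ?thesis by (simp add: L_def dist_pt real_le_rsqrt)
qed

lemma open_E: "open E"
  unfolding E_def X_def Y_def by (intro open_Collect_less continuous_intros) (use a_pos b_pos in auto)

lemma L_in_frontier:
  assumes "norm z = 1"
  shows "L z \<in> frontier E"
proof -
  have "L z \<in> closure E"
    unfolding closure_approachable
  proof (intro allI impI)
    fix e :: real assume "e > 0"
    \<comment> \<open>The point is approached along the radius. The bound 1 keeps the factor
      \<open>1 - d\<close> nonnegative, and half of \<open>e\<close> leaves room for a strict
      inequality.\<close>
    define d where "d = min 1 (e / (2 * a))"
    have d: "0 < d" "d \<le> 1" "d \<le> e / (2 * a)" using \<open>e > 0\<close> a_pos by (auto simp: d_def)
    have "L (of_real (1 - d) * z) \<in> E"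
      using d assms by (simp add: L_in_E_iff norm_mult del: of_real_diff)
    moreover have "dist (L (of_real (1 - d) * z)) (L z) < e"
    proof -
      have "dist (of_real (1 - d) * z) z = d"
        using d assms by (simp add: dist_norm algebra_simps norm_mult)
      then have "dist (L (of_real (1 - d) * z)) (L z) \<le> a * d"
        using dist_L_le[of "of_real (1 - d) * z" z] by simp
      also have "\<dots> \<le> e / 2" using d(3) a_pos by (simp add: field_simps)
      finally show ?thesis using \<open>e > 0\<close> by simp
    qed
    ultimately show "\<exists>y\<in>E. dist y (L z) < e" by blast
  qed
  moreover have "L z \<notin> E" using assms by (simp add: L_in_E_iff)
  ultimately show ?thesis using open_E by (simp add: frontier_def interior_open)
qed

lemma frontier_E: "frontier E \<noteq> {}"
  using L_in_frontier[of 1] by auto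

section \<open>Boundary distance under the affine map, and the upper bound\<close>

lemma bdist_L_le:
  assumes "norm z < 1"
  shows "bdist E (L z) \<le> a * (1 - norm z)"
proof -
  \<comment> \<open>The radial projection to the unit circle; at the centre any unit vector
    serves.\<close>
  obtain q where "norm q = 1" "z = of_real (norm z) * q"
  proof (cases "z = 0")
    case True
    then show ?thesis using that[of 1] by simp
  next
    case False
    then show ?thesis using that[of "sgn z"] by (simp add: norm_sgn) (simp add: sgn_eq)
  qed
  then have "z - q = of_real (norm z - 1) * q" by (simp add: algebra_simps)
  then have "dist z q = 1 - norm z"
    using assms \<open>norm q = 1\<close> by (simp add: dist_norm norm_mult del: of_real_diff)
  then show ?thesis
    using infdist_le[OF L_in_frontier[OF \<open>norm q = 1\<close>], of "L z"] dist_L_le[of z q]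
    by (simp add: bdist_def)
qed

text \<open>\<open>L\<close> shrinks distances by at most the factor \<open>b\<close>, so the
  preimage of this ball lies in the disc of radius \<open>1 - norm z\<close> about
  \<open>z\<close>.\<close>

lemma bdist_L_ge:
  assumes "norm z < 1"
  shows "b * (1 - norm z) \<le> bdist E (L z)"
proof (rule bdist_geI[OF open_E frontier_E], rule subsetI)
  fix w assume w: "w \<in> ball (L z) (b * (1 - norm z))"
  obtain q where q: "w = L q" using L_surj .
  have "b * dist z q < b * (1 - norm z)" using w dist_L_ge[of z q] q by simp
  then have "dist z q < 1 - norm z" using b_pos by simp
  then have "norm q < 1" using norm_triangle_ineq2[of q z] by (simp add: dist_norm norm_minus_commute)
  then show "w \<in> E" by (simp add: q L_in_E_iff)
qed

text \<open>The curve is the image under \<open>L\<close> of the hyperbolic geodesic: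
  \<open>L\<close> stretches by at most \<open>a\<close>, and the new density is at most
  \<open>1 / b\<close> times the hyperbolic one.\<close>

lemma qh_path_exists:
  assumes xy: "norm x < 1" "norm y < 1"
  defines "r \<equiv> norm (x - y) / norm (1 - cnj x * y)"
  obtains g where "rectifiable_path g" "path_image g \<subseteq> E" "pathstart g = L x" "pathfinish g = L y"
    "arclength_integral (\<lambda>z. 1 / bdist E z) g \<le> a / b * (ln (1 + r) - ln (1 - r))"
proof -
  have r: "0 \<le> r" "r < 1" using hyperbolic_dist_le_j(1)[OF xy] by (auto simp: r_def)
  obtain \<gamma> \<gamma>' :: "real \<Rightarrow> complex"
    where ends: "\<gamma> 0 = x" "\<gamma> 1 = y" and in_disc: "\<And>t. t \<in> {0..1} \<Longrightarrow> norm (\<gamma> t) < 1"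
      and deriv: "\<And>t. t \<in> {0..1} \<Longrightarrow> (\<gamma> has_vector_derivative \<gamma>' t) (at t)"
      and speed: "\<And>t. t \<in> {0..1} \<Longrightarrow> norm (\<gamma>' t) / (1 - (norm (\<gamma> t))\<^sup>2) = r / (1 - (t * r)\<^sup>2)"
    using moebius_ray[OF xy] unfolding r_def by metis
  \<comment> \<open>The hyperbolic length of the geodesic up to time \<open>t\<close>, times
    \<open>a / b\<close>; it is the majorant for \<open>arclength_integral_le\<close>.\<close>
  define h where "h t = a / b * (ln (1 + t * r) - ln (1 - t * r))" for t
  have tr: "0 \<le> t * r" "t * r < 1" if "t \<in> {0..1}" for t
    using that r mult_left_le_one_le[of r t] by auto
  have h': "(h has_vector_derivative a / b * (2 * r / (1 - (t * r)\<^sup>2))) (at t)" if "t \<in> {0..1}" for t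
  proof -
    have "1 - (t * r)\<^sup>2 = (1 + t * r) * (1 - t * r)" by (simp add: power2_eq_square algebra_simps)
    then have eq: "2 * r / (1 - (t * r)\<^sup>2) = r / (1 + t * r) + r / (1 - t * r)"
      using tr[OF that] by (simp add: divide_simps) (simp add: algebra_simps)
    have "((\<lambda>t. ln (1 + t * r) - ln (1 - t * r)) has_real_derivative 2 * r / (1 - (t * r)\<^sup>2)) (at t)"
      unfolding eq using tr[OF that] by (auto intro!: derivative_eq_intros)
    then show ?thesis
      unfolding h_def has_real_derivative_iff_has_vector_derivative[symmetric] by (rule DERIV_cmult)
  qed
  have cont_\<gamma>: "continuous_on {0..1} \<gamma>"
    using deriv by (intro continuous_at_imp_continuous_on ballI has_vector_derivative_continuous) auto
  define g where "g t = L (\<gamma> t)" for t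
  have "path g"
    unfolding path_def g_def L_def pt_def by (intro continuous_intros cont_\<gamma>)
  have pos: "0 < bdist E (g t)" if "t \<in> {0..1}" for t
    using bdist_pos[OF open_E frontier_E] in_disc[OF that] by (simp add: g_def L_in_E_iff)
  have bd: "1 / bdist E (g t) \<ge> 1 / a" if "t \<in> {0..1}" for t
  proof -
    have "bdist E (g t) \<le> a * (1 - norm (\<gamma> t))"
      unfolding g_def by (rule bdist_L_le[OF in_disc[OF that]])
    also have "\<dots> \<le> a" using a_pos by (simp add: algebra_simps)
    finally show ?thesis using pos[OF that] by (intro divide_left_mono) auto
  qed
  have step: "k * dist (g t) (g s) \<le> h t - h s"
    if st: "0 \<le> s" "s \<le> t" "t \<le> 1" and k: "0 \<le> k" "\<And>q. q \<in> {s..t} \<Longrightarrow> k \<le> 1 / bdist E (g q)" for s t k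
  proof (cases "s < t")
    case True
    \<comment> \<open>The mean value inequality is applied to the curve \<gamma> in the disc; the
      factor \<open>a\<close> accounts for \<open>L\<close>.\<close>
    have "norm ((k * a) *\<^sub>R \<gamma> t - (k * a) *\<^sub>R \<gamma> s) \<le> h t - h s"
    proof (rule differentiable_bound_general[OF True])
      show "continuous_on {s..t} (\<lambda>q. (k * a) *\<^sub>R \<gamma> q)"
        using continuous_on_subset[OF cont_\<gamma>, of "{s..t}"] st by (intro continuous_intros) auto
      show "continuous_on {s..t} h"
        using st by (intro continuous_at_imp_continuous_on ballI has_vector_derivative_continuous[OF h']) auto
    next
      fix q assume q: "s < q" "q < t"
      then have q01: "q \<in> {0..1}" using st by auto
      show "((\<lambda>q. (k * a) *\<^sub>R \<gamma> q) has_vector_derivative (k * a) *\<^sub>R \<gamma>' q) (at q)"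
        by (rule bounded_linear.has_vector_derivative[OF bounded_linear_scaleR_right deriv[OF q01]])
      show "(h has_vector_derivative a / b * (2 * r / (1 - (q * r)\<^sup>2))) (at q)"
        by (rule h'[OF q01])
      define n where "n = norm (\<gamma> q)"
      have n: "0 \<le> n" "n < 1" using in_disc[OF q01] by (auto simp: n_def)
      have "b * (1 - n) \<le> bdist E (g q)"
        unfolding g_def n_def by (rule bdist_L_ge[OF in_disc[OF q01]])
      then have "k \<le> 1 / (b * (1 - n))"
        using k(2)[of q] q b_pos n pos[OF q01]
        by (meson atLeastAtMost_iff divide_left_mono less_imp_le mult_pos_pos order_trans zero_le_one diff_gt_0_iff_gt)
      also have "\<dots> = (1 + n) / (b * (1 - n\<^sup>2))"
      proof -
        have "1 - n\<^sup>2 = (1 - n) * (1 + n)" by (simp add: power2_eq_square algebra_simps)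
        then show ?thesis using n b_pos by simp
      qed
      also have "\<dots> \<le> 2 / (b * (1 - n\<^sup>2))"
        using n b_pos by (intro divide_right_mono) (auto simp: power_le_one)
      finally have "k * a * norm (\<gamma>' q) \<le> 2 / (b * (1 - n\<^sup>2)) * a * norm (\<gamma>' q)"
        using a_pos by (intro mult_right_mono) auto
      also have "\<dots> = 2 * a / b * (norm (\<gamma>' q) / (1 - n\<^sup>2))" by simp
      also have "\<dots> = a / b * (2 * r / (1 - (q * r)\<^sup>2))"
        unfolding n_def speed[OF q01] by simp
      finally show "norm ((k * a) *\<^sub>R \<gamma>' q) \<le> a / b * (2 * r / (1 - (q * r)\<^sup>2))"
        using k a_pos by simp
    qed
    then have "k * a * dist (\<gamma> t) (\<gamma> s) \<le> h t - h s"
      using k a_pos by (simp add: dist_norm flip: scaleR_diff_right)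
    moreover have "k * dist (g t) (g s) \<le> k * (a * dist (\<gamma> t) (\<gamma> s))"
      unfolding g_def using k dist_L_le by (intro mult_left_mono) auto
    ultimately show ?thesis by (simp add: mult.assoc)
  next
    case False
    then show ?thesis using st by simp
  qed
  have "1 / a > 0" using a_pos by simp
  note bounds = arclength_integral_le[where f = "\<lambda>z. 1 / bdist E z" and h = h, OF \<open>path g\<close> this bd step]
  show thesis
  proof
    show "rectifiable_path g" by (rule bounds(1))
    show "path_image g \<subseteq> E" using in_disc by (auto simp: path_image_def g_def L_in_E_iff)
    show "pathstart g = L x" "pathfinish g = L y" by (auto simp: pathstart_def pathfinish_def g_def ends)
    have "arclength_integral (\<lambda>z. 1 / bdist E z) g \<le> h 1 - h 0" by (rule bounds(2))
    then show "arclength_integral (\<lambda>z. 1 / bdist E z) g \<le> a / b * (ln (1 + r) - ln (1 - r))"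
      by (simp add: h_def)
  qed
qed

lemma qh_dist_le_j_dist:
  assumes "x \<in> E" "y \<in> E"
  shows "qh_dist E x y \<le> 2 * (a / b)\<^sup>2 * j_dist E x y"
proof -
  obtain z w where zw: "x = L z" "y = L w" using L_surj by metis
  then have n: "norm z < 1" "norm w < 1" using assms by (auto simp: L_in_E_iff)
  define c where "c = a / b"
  have "c \<ge> 1" using b_pos b_le_a by (simp add: c_def)
  define m where "m = min (1 - norm z) (1 - norm w)"
  have "m > 0" using n by (simp add: m_def)
  define d where "d = min (bdist E x) (bdist E y)"
  have "d > 0"
    using assms bdist_pos[OF open_E frontier_E] by (simp add: d_def)
  have "d \<le> a * m"
    using bdist_L_le[OF n(1)] bdist_L_le[OF n(2)] by (auto simp: d_def m_def zw min_def)
  define \<rho> where "\<rho> = norm (z - w) / norm (1 - cnj z * w)"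
  obtain g where g: "rectifiable_path g" "path_image g \<subseteq> E" "pathstart g = x" "pathfinish g = y"
    and len: "arclength_integral (\<lambda>z. 1 / bdist E z) g \<le> c * (ln (1 + \<rho>) - ln (1 - \<rho>))"
    using qh_path_exists[OF n] unfolding zw c_def \<rho>_def by metis
  have "qh_dist E x y \<le> c * (ln (1 + \<rho>) - ln (1 - \<rho>))"
    using qh_dist_le[OF open_E frontier_E g] len by simp
  also have "\<dots> \<le> c * (2 * ln (1 + dist z w / m))"
    using hyperbolic_dist_le_j(2)[OF n] \<open>c \<ge> 1\<close>
    by (intro mult_left_mono) (auto simp: \<rho>_def m_def dist_norm)
  also have "\<dots> \<le> c * (2 * (c * ln (1 + dist x y / d)))"
  proof (intro mult_left_mono)
    \<comment> \<open>Passing to the ellipse shrinks distances by at most \<open>b\<close> and gives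
      boundary distances at most \<open>a\<close> times larger, so the quotient loses at most the
      factor \<open>c\<close>.\<close>
    have "dist z w / m = c * (b * dist z w / (a * m))"
      using a_pos b_pos by (simp add: c_def)
    also have "\<dots> \<le> c * (dist x y / d)"
      using \<open>c \<ge> 1\<close> \<open>d > 0\<close> \<open>d \<le> a * m\<close> dist_L_ge[of z w] b_pos
      by (intro mult_left_mono frac_le) (auto simp: zw)
    finally have "ln (1 + dist z w / m) \<le> ln (1 + c * (dist x y / d))"
      using \<open>m > 0\<close> by (intro ln_mono) (auto intro: add_pos_nonneg)
    also have "\<dots> \<le> c * ln (1 + dist x y / d)"
      using \<open>c \<ge> 1\<close> \<open>d > 0\<close> by (intro ln_one_plus_mult_le) auto
    finally show "ln (1 + dist z w / m) \<le> c * ln (1 + dist x y / d)" .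
  qed (use \<open>c \<ge> 1\<close> in auto)
  also have "\<dots> = 2 * c\<^sup>2 * j_dist E x y"
    by (simp add: j_dist_def d_def power2_eq_square)
  finally show ?thesis by (simp add: c_def)
qed

section \<open>Tools for the lower bounds\<close>

lemma qh_dist_E_ge_calibration:
  assumes "x \<in> E" "y \<in> E"
    and "\<And>z w. z \<in> E \<Longrightarrow> w \<in> E \<Longrightarrow> F z - F w \<le> dist z w * max (1 / bdist E z) (1 / bdist E w)"
  shows "F y - F x \<le> qh_dist E x y"
proof -
  obtain z w where zw: "x = L z" "y = L w" using L_surj by metis
  then have n: "norm z < 1" "norm w < 1" using assms by (auto simp: L_in_E_iff)
  \<comment> \<open>Any curve in \<open>E\<close> will do: it shows that the infimum in
    \<open>qh_dist\<close> has a competitor.\<close>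
  obtain g where "rectifiable_path g" "path_image g \<subseteq> E" "pathstart g = x" "pathfinish g = y"
    using qh_path_exists[OF n] unfolding zw by metis
  from qh_dist_ge_calibration[OF open_E frontier_E this assms(3)] show ?thesis .
qed

text \<open>Used to bound \<open>bdist\<close> from above: a displacement \<open>(h, k)\<close> that
  leads out of the ellipse cannot be shorter than \<open>bdist E w\<close>.\<close>

lemma translate_in_E:
  assumes "w \<in> E" "sqrt (h\<^sup>2 + k\<^sup>2) < bdist E w"
  shows "(X w + h)\<^sup>2 / a\<^sup>2 + (Y w + k)\<^sup>2 / b\<^sup>2 < 1"
proof -
  have "dist w (pt (X w + h) (Y w + k)) = sqrt (h\<^sup>2 + k\<^sup>2)"
    using dist_pt[of "X w" "Y w" "X w + h" "Y w + k"] by simp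
  then have "pt (X w + h) (Y w + k) \<in> E"
    using ball_bdist_subset[OF assms(1)] assms(2) by auto
  then show ?thesis by (simp add: E_def)
qed

section \<open>Lower bound along the minor axis\<close>

lemma abs_Y_less:
  assumes "w \<in> E"
  shows "\<bar>Y w\<bar> < b"
proof -
  have "(X w)\<^sup>2 / a\<^sup>2 + (Y w)\<^sup>2 / b\<^sup>2 < 1" using assms by (simp add: E_def)
  moreover have "0 \<le> (X w)\<^sup>2 / a\<^sup>2" by simp
  ultimately have "(Y w)\<^sup>2 / b\<^sup>2 < 1" by linarith
  then have "(Y w / b)\<^sup>2 < 1" by (simp add: power_divide)
  then have "\<bar>Y w / b\<bar> < 1" by (simp only: abs_square_less_1)
  then show ?thesis using b_pos by simp
qed

lemma dist_ge_X: "\<bar>X z - X w\<bar> \<le> dist z w" and dist_ge_Y: "\<bar>Y z - Y w\<bar> \<le> dist z w"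
proof -
  have "dist z w = sqrt ((X z - X w)\<^sup>2 + (Y z - Y w)\<^sup>2)"
    using dist_pt[of "X z" "Y z" "X w" "Y w"] by simp
  then show "\<bar>X z - X w\<bar> \<le> dist z w" "\<bar>Y z - Y w\<bar> \<le> dist z w"
    by (auto intro: real_le_rsqrt)
qed

lemma bdist_le_strip:
  assumes "w \<in> E"
  shows "bdist E w \<le> b - \<bar>Y w\<bar>"
proof (rule ccontr)
  assume "\<not> bdist E w \<le> b - \<bar>Y w\<bar>"
  then have *: "b - \<bar>Y w\<bar> < bdist E w" by simp
  \<comment> \<open>The vertical move to the nearer side of the strip.\<close>
  define k where "k = (if Y w \<ge> 0 then b - Y w else - b - Y w)"
  have "\<bar>k\<bar> = b - \<bar>Y w\<bar>" using abs_Y_less[OF assms] by (auto simp: k_def)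
  then have "(X w + 0)\<^sup>2 / a\<^sup>2 + (Y w + k)\<^sup>2 / b\<^sup>2 < 1"
    using * by (intro translate_in_E[OF assms]) auto
  moreover have "(Y w + k)\<^sup>2 / b\<^sup>2 = 1" using b_pos by (simp add: k_def)
  moreover have "0 \<le> (X w + 0)\<^sup>2 / a\<^sup>2" by simp
  ultimately show False by linarith
qed

text \<open>The two points tend to the ends of the minor axis as \<open>t\<close> tends to 0, and
  the ratio of \<open>2 * ln (1 / t)\<close> to \<open>ln (2 / t)\<close> tends to 2.\<close>

lemma qh_dist_minor_axis_ge:
  assumes t: "0 < t" "t < 1"
  defines "x \<equiv> pt 0 (- (b * (1 - t)))" and "y \<equiv> pt 0 (b * (1 - t))"
  shows "x \<in> E" "y \<in> E" "2 * ln (1 / t) \<le> qh_dist E x y" "j_dist E x y \<le> ln (2 / t)"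
proof -
  have xy: "x = L (Complex 0 (- (1 - t)))" "y = L (Complex 0 (1 - t))"
    by (auto simp: x_def y_def L_def algebra_simps)
  have n: "norm (Complex 0 (- (1 - t))) = 1 - t" "norm (Complex 0 (1 - t)) = 1 - t"
    using t by (auto simp: cmod_def)
  show E: "x \<in> E" "y \<in> E" using t n by (simp_all add: xy L_in_E_iff)
  \<comment> \<open>The odd antiderivative of \<open>1 / (b - |Y|)\<close>. One summand is constant
    above the major axis, the other below, so no case split on the signs is needed.\<close>
  define F where "F w = ln (b + min (Y w) 0) - ln (b - max (Y w) 0)" for w
  have F: "F z - F w \<le> dist z w * max (1 / bdist E z) (1 / bdist E w)" if "z \<in> E" "w \<in> E" for z w
  proof -
    define m where "m = max (1 / bdist E z) (1 / bdist E w)"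
    have "1 / (b - \<bar>Y q\<bar>) \<le> 1 / bdist E q" if "q \<in> E" for q
      using bdist_le_strip[OF that] abs_Y_less[OF that] bdist_pos[OF open_E frontier_E that]
      by (intro divide_left_mono) auto
    then have m: "1 / (b - \<bar>Y z\<bar>) \<le> m" "1 / (b - \<bar>Y w\<bar>) \<le> m"
      using that unfolding m_def by (meson max.coboundedI1 max.coboundedI2)+
    have Yb: "\<bar>Y z\<bar> < b" "\<bar>Y w\<bar> < b" using abs_Y_less that by auto
    have "m > 0" using m(1) Yb(1) by (smt (verit) divide_pos_pos)
    have ln_diff: "ln (b - s) - ln (b - s') \<le> \<bar>s' - s\<bar> * m"
      if "s < b" "s' < b" "1 / (b - s') \<le> m" for s s'
    proof -
      have "ln (b - s) - ln (b - s') \<le> (b - s - (b - s')) / (b - s')"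
        using that by (intro ln_diff_le) auto
      also have "\<dots> = (s' - s) * (1 / (b - s'))" by simp
      also have "\<dots> \<le> \<bar>s' - s\<bar> * (1 / (b - s'))"
        using that by (intro mult_right_mono) auto
      also have "\<dots> \<le> \<bar>s' - s\<bar> * m" using that by (intro mult_left_mono) auto
      finally show ?thesis .
    qed
    have "F z - F w = (ln (b - (- min (Y z) 0)) - ln (b - (- min (Y w) 0)))
        + (ln (b - max (Y w) 0) - ln (b - max (Y z) 0))"
      by (simp add: F_def)
    also have "\<dots> \<le> \<bar>- min (Y w) 0 - (- min (Y z) 0)\<bar> * m + \<bar>max (Y z) 0 - max (Y w) 0\<bar> * m"
    proof (intro add_mono ln_diff)
      have "1 / (b - s) \<le> 1 / (b - \<bar>Y q\<bar>)" if "s \<le> \<bar>Y q\<bar>" "\<bar>Y q\<bar> < b" for s q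
        using that by (intro divide_left_mono) auto
      then show "1 / (b - (- min (Y w) 0)) \<le> m" "1 / (b - max (Y z) 0) \<le> m"
        using m Yb by (smt (verit))+
    qed (use Yb in auto)
    \<comment> \<open>The parts \<open>min (Y _) 0\<close> and \<open>max (Y _) 0\<close> add up to
      \<open>Y\<close> and are both monotone in it, so their absolute increments add up.\<close>
    also have "\<dots> = \<bar>Y z - Y w\<bar> * m"
      by (auto simp: min_def max_def abs_if algebra_simps)
    also have "\<dots> \<le> dist z w * m"
      using dist_ge_Y \<open>m > 0\<close> by (intro mult_right_mono) auto
    finally show ?thesis by (simp add: m_def)
  qed
  have "F y - F x \<le> qh_dist E x y" by (rule qh_dist_E_ge_calibration[OF E F])
  moreover have "F y - F x = 2 * ln (1 / t)"
  proof -
    have "b * (1 - t) \<ge> 0" "b - b * (1 - t) = b * t" using t b_pos by (auto simp: algebra_simps)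
    then have "F y - F x = 2 * (ln b - ln (b * t))"
      by (simp add: F_def x_def y_def)
    then show ?thesis using t b_pos by (simp add: ln_mult ln_div)
  qed
  ultimately show "2 * ln (1 / t) \<le> qh_dist E x y" by simp
  have d: "b * t \<le> bdist E x" "b * t \<le> bdist E y"
    using bdist_L_ge[of "Complex 0 (- (1 - t))"] bdist_L_ge[of "Complex 0 (1 - t)"] t
    unfolding xy n by auto
  have "dist x y = 2 * b * (1 - t)"
    using t b_pos by (simp add: x_def y_def dist_pt algebra_simps)
  then have "dist x y / min (bdist E x) (bdist E y) \<le> 2 * b * (1 - t) / (b * t)"
    using d t b_pos by (intro frac_le) auto
  also have "\<dots> = 2 * (1 - t) / t" using b_pos by simp
  finally have "1 + dist x y / min (bdist E x) (bdist E y) \<le> 1 + 2 * (1 - t) / t" by simp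
  also have "\<dots> \<le> 2 / t" using t by (simp add: field_simps)
  finally have "1 + dist x y / min (bdist E x) (bdist E y) \<le> 2 / t" .
  moreover have "0 < b * t" using t b_pos by simp
  then have "0 < 1 + dist x y / min (bdist E x) (bdist E y)"
    using d by (intro add_pos_nonneg divide_nonneg_nonneg) auto
  ultimately show "j_dist E x y \<le> ln (2 / t)"
    unfolding j_dist_def by (rule ln_mono)
qed

section \<open>Lower bound along the major axis\<close>

text \<open>The right side is the length of the move from \<open>(s, 0)\<close> to its foot on the
  ellipse, where \<open>s\<close> is \<open>X w\<close> clamped to the segment between the centres
  of curvature \<open>- q\<close> and \<open>q\<close>. The same move, made on the side of
  \<open>w\<close>, leads from \<open>w\<close> out of the ellipse.\<close>

lemma bdist_le_axis:
  assumes "b < a" "w \<in> E"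
  defines "q \<equiv> (a\<^sup>2 - b\<^sup>2) / a"
  defines "s \<equiv> max (- q) (min q (X w))"
  shows "bdist E w \<le> b * sqrt (1 - s\<^sup>2 / (a\<^sup>2 - b\<^sup>2))"
proof (rule ccontr)
  assume "\<not> bdist E w \<le> b * sqrt (1 - s\<^sup>2 / (a\<^sup>2 - b\<^sup>2))"
  then have less: "b * sqrt (1 - s\<^sup>2 / (a\<^sup>2 - b\<^sup>2)) < bdist E w" by simp
  define e where "e = a\<^sup>2 - b\<^sup>2"
  have "e > 0" using assms(1) b_pos by (simp add: e_def power_strict_mono)
  have "q > 0" using \<open>e > 0\<close> a_pos by (simp add: q_def e_def)
  have "\<bar>s\<bar> \<le> q" using \<open>q > 0\<close> by (auto simp: s_def)
  \<comment> \<open>The first coordinate of the foot divided by \<open>a\<close>, the cosine of its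
    eccentric angle. It lies between -1 and 1 because \<open>|s| \<le> q\<close>.\<close>
  define m where "m = s * a / e"
  have "\<bar>m\<bar> = \<bar>s\<bar> * a / e"
    using a_pos \<open>e > 0\<close> by (simp add: m_def abs_mult)
  also have "\<dots> \<le> q * a / e"
    using \<open>\<bar>s\<bar> \<le> q\<close> a_pos \<open>e > 0\<close> by (intro divide_right_mono mult_right_mono) auto
  also have "\<dots> = 1" using a_pos \<open>e > 0\<close> by (simp add: q_def e_def)
  finally have m: "m\<^sup>2 \<le> 1" by (simp add: abs_square_le_1)
  \<comment> \<open>The points of the ellipse nearest to (s, 0) are (s, 0) + (h, k) and (s, 0) + (h, -k).\<close>
  define h where "h = s * b\<^sup>2 / e"
  define k where "k = (if Y w \<ge> 0 then b * sqrt (1 - m\<^sup>2) else - (b * sqrt (1 - m\<^sup>2)))"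
  have k2: "k\<^sup>2 = b\<^sup>2 * (1 - m\<^sup>2)" using m by (simp add: k_def power_mult_distrib)
  have "h\<^sup>2 + k\<^sup>2 = b\<^sup>2 * (1 - s\<^sup>2 / e)"
  proof -
    have "h\<^sup>2 + k\<^sup>2 = b\<^sup>2 - b\<^sup>2 * s\<^sup>2 * (a\<^sup>2 - b\<^sup>2) / e\<^sup>2"
      unfolding k2 by (simp add: h_def m_def power_divide power_mult_distrib diff_divide_distrib algebra_simps)
    also have "\<dots> = b\<^sup>2 * (1 - s\<^sup>2 / e)"
      unfolding e_def[symmetric] using \<open>e > 0\<close> by (simp add: power2_eq_square right_diff_distrib)
    finally show ?thesis .
  qed
  then have "sqrt (h\<^sup>2 + k\<^sup>2) = b * sqrt (1 - s\<^sup>2 / e)"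
    using b_pos by (simp add: real_sqrt_mult)
  then have "(X w + h)\<^sup>2 / a\<^sup>2 + (Y w + k)\<^sup>2 / b\<^sup>2 < 1"
    using less by (intro translate_in_E[OF assms(2)]) (simp add: e_def)
  moreover have "m\<^sup>2 \<le> (X w + h)\<^sup>2 / a\<^sup>2"
  proof -
    have hs: "0 \<le> h \<longleftrightarrow> 0 \<le> s" "h \<le> 0 \<longleftrightarrow> s \<le> 0"
      using b_pos \<open>e > 0\<close> by (auto simp: h_def zero_le_divide_iff divide_le_0_iff zero_le_mult_iff mult_le_0_iff)
    \<comment> \<open>If the clamp changes \<open>X w\<close>, then \<open>X w\<close> lies beyond
      \<open>s\<close> on the same side of 0, and \<open>h\<close> has the sign of
      \<open>s\<close>.\<close>
    have "\<bar>s + h\<bar> \<le> \<bar>X w + h\<bar>"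
    proof (cases "X w = s")
      case False
      then have "s = q \<and> q < X w \<or> s = - q \<and> X w < - q"
        using \<open>q > 0\<close> by (auto simp: s_def min_def max_def split: if_splits)
      then show ?thesis using hs \<open>q > 0\<close> by auto
    qed simp
    then have "(s + h)\<^sup>2 \<le> (X w + h)\<^sup>2" by (simp add: abs_le_square_iff)
    moreover have "s + h = m * a"
      using \<open>e > 0\<close> by (simp add: h_def m_def field_simps) (simp add: e_def power2_eq_square algebra_simps)
    ultimately show ?thesis using a_pos by (simp add: field_simps power_mult_distrib)
  qed
  moreover have "1 - m\<^sup>2 \<le> (Y w + k)\<^sup>2 / b\<^sup>2"
  proof -
    have "0 \<le> b * sqrt (1 - m\<^sup>2)" using b_pos m by simp
    then have "\<bar>k\<bar> \<le> \<bar>Y w + k\<bar>" by (auto simp: k_def)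
    then have "k\<^sup>2 \<le> (Y w + k)\<^sup>2" by (simp add: abs_le_square_iff)
    then show ?thesis using b_pos by (simp add: k2 field_simps)
  qed
  ultimately show False by linarith
qed

text \<open>The osculating disc at the vertex \<open>(\<sigma> * a, 0)\<close> has radius
  \<open>b\<^sup>2 / a\<close> and lies inside the ellipse; \<sigma> treats both vertices at
  once.\<close>

lemma bdist_curvature_center_ge:
  assumes "\<sigma>\<^sup>2 = 1"
  shows "b\<^sup>2 / a \<le> bdist E (pt (\<sigma> * ((a\<^sup>2 - b\<^sup>2) / a)) 0)"
proof (rule bdist_geI[OF open_E frontier_E], rule subsetI)
  define q where "q = (a\<^sup>2 - b\<^sup>2) / a"
  fix w assume "w \<in> ball (pt (\<sigma> * ((a\<^sup>2 - b\<^sup>2) / a)) 0) (b\<^sup>2 / a)"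
  then have "sqrt ((\<sigma> * q - X w)\<^sup>2 + (0 - Y w)\<^sup>2) < b\<^sup>2 / a"
    using dist_pt[of "\<sigma> * q" 0 "X w" "Y w"] by (simp add: q_def)
  then have "(\<sigma> * q - X w)\<^sup>2 + (Y w)\<^sup>2 < (b\<^sup>2 / a)\<^sup>2"
    using power_strict_mono[of "sqrt ((\<sigma> * q - X w)\<^sup>2 + (0 - Y w)\<^sup>2)" "b\<^sup>2 / a" 2] by simp
  then have "a\<^sup>2 * ((\<sigma> * q - X w)\<^sup>2 + (Y w)\<^sup>2) < a\<^sup>2 * (b\<^sup>2 / a)\<^sup>2"
    using a_pos by simp
  moreover have "a\<^sup>2 * ((\<sigma> * q - X w)\<^sup>2 + (Y w)\<^sup>2) = (\<sigma> * (a * q) - a * X w)\<^sup>2 + a\<^sup>2 * (Y w)\<^sup>2"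
    by (simp add: power2_eq_square algebra_simps)
  moreover have "a\<^sup>2 * (b\<^sup>2 / a)\<^sup>2 = b ^ 4"
    using a_pos by (simp add: power_divide flip: power_mult)
  ultimately have "(\<sigma> * (a\<^sup>2 - b\<^sup>2) - a * X w)\<^sup>2 + a\<^sup>2 * (Y w)\<^sup>2 < b ^ 4"
    using a_pos by (simp add: q_def)
  moreover have "0 \<le> (a\<^sup>2 - b\<^sup>2) * (X w - \<sigma> * a)\<^sup>2"
    using b_pos b_le_a by (simp add: power_mono)
  \<comment> \<open>The slack in the ellipse inequality is the slack in the disc inequality plus a
    nonnegative multiple of a square that vanishes at the vertex.\<close>
  moreover have "a\<^sup>2 * b\<^sup>2 - b\<^sup>2 * (X w)\<^sup>2 - a\<^sup>2 * (Y w)\<^sup>2 =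
      b ^ 4 - ((\<sigma> * (a\<^sup>2 - b\<^sup>2) - a * X w)\<^sup>2 + a\<^sup>2 * (Y w)\<^sup>2) + (a\<^sup>2 - b\<^sup>2) * (X w - \<sigma> * a)\<^sup>2"
    using assms by algebra
  ultimately have "b\<^sup>2 * (X w)\<^sup>2 + a\<^sup>2 * (Y w)\<^sup>2 < a\<^sup>2 * b\<^sup>2" by linarith
  then show "w \<in> E" using a_pos b_pos by (simp add: E_def field_simps)
qed

text \<open>\<open>K / b * arcsin (x / K)\<close> is an antiderivative of \<open>1 / R\<close>, and
  \<open>1 / R\<close> grows with \<open>|x|\<close>. Hence its value at the mean value point is at
  most the larger of the two end values. The bound \<open>q < K\<close> keeps away from the
  singularities.\<close>

lemma arcsin_calibration:
  fixes K q s t :: real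
  assumes K: "0 < K" "q < K" "\<bar>s\<bar> \<le> q" "\<bar>t\<bar> \<le> q"
  defines "R \<equiv> \<lambda>x. b * sqrt (1 - x\<^sup>2 / K\<^sup>2)"
  shows "K / b * arcsin (t / K) - K / b * arcsin (s / K) \<le> \<bar>t - s\<bar> * max (1 / R t) (1 / R s)"
proof -
  have small: "x\<^sup>2 / K\<^sup>2 < 1" if "\<bar>x\<bar> \<le> q" for x
  proof -
    have "\<bar>x / K\<bar> < 1" using that K by simp
    then show ?thesis by (simp add: abs_square_less_1 flip: power_divide)
  qed
  show ?thesis
  proof (cases "s < t")
    case True
    have "((\<lambda>x. K / b * arcsin (x / K)) has_real_derivative 1 / R x) (at x)" if "s \<le> x" "x \<le> t" for x
    proof -
      have "\<bar>x\<bar> \<le> q" using that K by linarith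
      then have "- K < x" "x < K" using K by linarith+
      then have "- 1 < x / K" "x / K < 1" using K by (auto simp: field_simps)
      then have "((\<lambda>x. K / b * arcsin (x / K)) has_real_derivative K / b * (inverse (sqrt (1 - (x / K)\<^sup>2)) * (1 / K))) (at x)"
        using K b_pos by (auto intro!: derivative_eq_intros)
      moreover have "K / b * (inverse (sqrt (1 - (x / K)\<^sup>2)) * (1 / K)) = 1 / R x"
        using K(1) by (simp add: R_def power_divide inverse_eq_divide)
      ultimately show ?thesis by simp
    qed
    then obtain x where x: "s < x" "x < t"
      and eq: "K / b * arcsin (t / K) - K / b * arcsin (s / K) = (t - s) * (1 / R x)"
      using MVT2[OF True, of "\<lambda>x. K / b * arcsin (x / K)" "\<lambda>x. 1 / R x"] by blast
    have mono: "1 / R x \<le> 1 / R y" if "\<bar>x\<bar> \<le> \<bar>y\<bar>" "\<bar>y\<bar> \<le> q" for y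
    proof -
      have "x\<^sup>2 / K\<^sup>2 \<le> y\<^sup>2 / K\<^sup>2" using that(1) by (simp add: abs_le_square_iff divide_right_mono)
      then have "R y \<le> R x" "0 < R y"
        using small[OF that(2)] b_pos by (auto simp: R_def)
      then show ?thesis by (intro divide_left_mono) auto
    qed
    \<comment> \<open>A point between \<open>s\<close> and \<open>t\<close> does not exceed both in
      absolute value.\<close>
    have "1 / R x \<le> max (1 / R t) (1 / R s)"
    proof (cases "\<bar>x\<bar> \<le> \<bar>t\<bar>")
      case True
      then show ?thesis using mono[of t] K by simp
    next
      case False
      then show ?thesis using mono[of s] K x by (simp add: abs_if split: if_splits)
    qed
    then have "(t - s) * (1 / R x) \<le> (t - s) * max (1 / R t) (1 / R s)"
      using True by (intro mult_left_mono) auto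
    then show ?thesis unfolding eq using True by (simp only: abs_of_pos diff_gt_0_iff_gt)
  next
    case False
    then have "arcsin (t / K) \<le> arcsin (s / K)"
      using K by (intro arcsin_le_arcsin) (auto simp: field_simps)
    then have "K / b * arcsin (t / K) - K / b * arcsin (s / K) \<le> 0"
      using K b_pos by (simp add: mult_left_mono divide_right_mono)
    also have "0 \<le> 1 / R t" using K(4) small[of t] b_pos by (simp add: R_def)
    then have "0 \<le> \<bar>t - s\<bar> * max (1 / R t) (1 / R s)" by (simp add: le_max_iff_disj)
    finally show ?thesis .
  qed
qed

lemma qh_dist_major_axis_ge:
  assumes "b < a"
  defines "c \<equiv> a / b" and "q \<equiv> (a\<^sup>2 - b\<^sup>2) / a"
  defines "x \<equiv> pt (- q) 0" and "y \<equiv> pt q 0"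
  shows "x \<in> E" "y \<in> E"
    "2 * sqrt (c\<^sup>2 - 1) * arcsin (sqrt (1 - 1 / c\<^sup>2)) \<le> qh_dist E x y" "j_dist E x y \<le> ln (2 * c\<^sup>2 - 1)"
proof -
  \<comment> \<open>The distance from the centre to a focus. Thus
    \<open>K / b = sqrt (c\<^sup>2 - 1)\<close>, and
    \<open>q / K = K / a = sqrt (1 - 1 / c\<^sup>2)\<close> is the eccentricity.\<close>
  define K where "K = sqrt (a\<^sup>2 - b\<^sup>2)"
  have e: "a\<^sup>2 - b\<^sup>2 > 0" using assms(1) b_pos by (simp add: power_strict_mono)
  then have K: "0 < K" "K\<^sup>2 = a\<^sup>2 - b\<^sup>2" by (auto simp: K_def)
  have "K < a" using K(2) b_pos a_pos by (intro power2_less_imp_less[of K a]) auto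
  have qK: "q = K * (K / a)" using K by (simp add: q_def power2_eq_square)
  have "q < K * 1"
    unfolding qK using K(1) \<open>K < a\<close> a_pos by (intro mult_strict_left_mono) auto
  then have q: "0 < q" "q < K" using qK K(1) a_pos by auto
  have "(q / a)\<^sup>2 < 1" using q \<open>K < a\<close> a_pos by (simp add: abs_square_less_1)
  then show E: "x \<in> E" "y \<in> E" by (auto simp: E_def x_def y_def power_divide)
  \<comment> \<open>The clamp of \<open>bdist_le_axis\<close>; it is 1-Lipschitz in
    \<open>X w\<close> and fixes the coordinates of \<open>x\<close> and \<open>y\<close>.\<close>
  define cl where "cl w = max (- q) (min q (X w))" for w
  define R where "R t = b * sqrt (1 - t\<^sup>2 / K\<^sup>2)" for t
  define F where "F w = K / b * arcsin (cl w / K)" for w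
  have cl: "\<bar>cl w\<bar> \<le> q" for w using q by (auto simp: cl_def)
  have F: "F z - F w \<le> dist z w * max (1 / bdist E z) (1 / bdist E w)" if "z \<in> E" "w \<in> E" for z w
  proof -
    have R: "1 / R (cl v) \<le> 1 / bdist E v" "0 < 1 / bdist E v" if "v \<in> E" for v
    proof -
      have "0 < bdist E v" "bdist E v \<le> R (cl v)"
        using bdist_pos[OF open_E frontier_E that] bdist_le_axis[OF assms(1) that]
        by (auto simp: R_def cl_def q_def K)
      then show "1 / R (cl v) \<le> 1 / bdist E v" "0 < 1 / bdist E v"
        by (auto intro!: divide_left_mono)
    qed
    have "F z - F w \<le> \<bar>cl z - cl w\<bar> * max (1 / R (cl z)) (1 / R (cl w))"
      unfolding F_def R_def by (rule arcsin_calibration[OF K(1) q(2) cl cl])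
    also have "\<dots> \<le> \<bar>cl z - cl w\<bar> * max (1 / bdist E z) (1 / bdist E w)"
      using R(1) that by (intro mult_left_mono max.mono) auto
    also have "\<dots> \<le> dist z w * max (1 / bdist E z) (1 / bdist E w)"
    proof (rule mult_right_mono)
      have "\<bar>cl z - cl w\<bar> \<le> \<bar>X z - X w\<bar>" unfolding cl_def by linarith
      then show "\<bar>cl z - cl w\<bar> \<le> dist z w" using dist_ge_X[of z w] by linarith
      show "0 \<le> max (1 / bdist E z) (1 / bdist E w)"
        using R(2)[OF that(1)] by (simp add: le_max_iff_disj)
    qed
    finally show ?thesis .
  qed
  have "F y - F x \<le> qh_dist E x y" by (rule qh_dist_E_ge_calibration[OF E F])
  moreover have "F y - F x = 2 * sqrt (c\<^sup>2 - 1) * arcsin (sqrt (1 - 1 / c\<^sup>2))"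
  proof -
    have "c\<^sup>2 - 1 = (K / b)\<^sup>2" "1 - 1 / c\<^sup>2 = (K / a)\<^sup>2"
      using K a_pos b_pos by (auto simp: c_def power_divide field_simps)
    then have *: "sqrt (c\<^sup>2 - 1) = K / b" "sqrt (1 - 1 / c\<^sup>2) = K / a"
      using K(1) a_pos b_pos by simp_all
    have "cl y = q" "cl x = - q" using q by (auto simp: cl_def x_def y_def)
    moreover have "q / K = K / a" "- q / K = - (K / a)" using qK K(1) by auto
    moreover have "arcsin (- (K / a)) = - arcsin (K / a)"
      using K(1) \<open>K < a\<close> a_pos by (intro arcsin_minus) (auto simp: field_simps)
    ultimately show ?thesis unfolding F_def * by simp
  qed
  ultimately show "2 * sqrt (c\<^sup>2 - 1) * arcsin (sqrt (1 - 1 / c\<^sup>2)) \<le> qh_dist E x y" by simp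
  have d: "b\<^sup>2 / a \<le> min (bdist E x) (bdist E y)"
    using bdist_curvature_center_ge[of 1, folded q_def] bdist_curvature_center_ge[of "- 1", folded q_def]
    by (simp add: x_def y_def)
  have "0 < b\<^sup>2 / a" using a_pos b_pos by simp
  have "dist x y = 2 * q" using q by (simp add: x_def y_def dist_pt real_sqrt_mult)
  then have "dist x y / min (bdist E x) (bdist E y) \<le> 2 * q / (b\<^sup>2 / a)"
    using d \<open>0 < b\<^sup>2 / a\<close> q by (intro frac_le) auto
  also have "\<dots> = 2 * c\<^sup>2 - 2"
    using a_pos b_pos by (simp add: q_def c_def field_simps power2_eq_square)
  finally have "1 + dist x y / min (bdist E x) (bdist E y) \<le> 2 * c\<^sup>2 - 1" by simp
  moreover have "0 < 1 + dist x y / min (bdist E x) (bdist E y)"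
    using d \<open>0 < b\<^sup>2 / a\<close> by (intro add_pos_nonneg divide_nonneg_nonneg) auto
  ultimately show "j_dist E x y \<le> ln (2 * c\<^sup>2 - 1)"
    unfolding j_dist_def by (rule ln_mono)
qed

end

theorem theorem1p9:
  fixes E :: "(real^2) set" and p u v :: "real^2" and a b c :: real
  assumes "0 < b" and "b \<le> a"
    and "norm u = 1" and "norm v = 1" and "u \<bullet> v = 0"
    and "E = {z. ((z - p) \<bullet> u)\<^sup>2 / a\<^sup>2 + ((z - p) \<bullet> v)\<^sup>2 / b\<^sup>2 < 1}"
    and "c = a / b"
  shows "ereal 2 \<le> unif_const E
    \<and> (c > 1 \<longrightarrow>
         ereal (2 * sqrt (c\<^sup>2 - 1) * arcsin (sqrt (1 - 1 / c\<^sup>2)) / ln (2 * c\<^sup>2 - 1)) \<le> unif_const E)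
    \<and> unif_const E \<le> ereal (2 * c ^ 4)"
proof -
  interpret ell: ellipse p u v a b by unfold_locales (use assms in auto)
  have E: "E = ell.E" by (simp add: assms(6) ell.E_def ell.X_def ell.Y_def)
  have "c \<ge> 1" using assms by simp
  have "2 \<le> A" if A: "A \<ge> 1" "\<forall>x\<in>E. \<forall>y\<in>E. qh_dist E x y \<le> A * j_dist E x y" for A
  proof (rule ccontr)
    assume "\<not> 2 \<le> A"
    \<comment> \<open>Chosen so that \<open>(2 - A) * T\<close> exceeds \<open>A * ln 2\<close> by
      exactly \<open>2 - A\<close>; below, \<open>ln (1 / t) = T\<close>.\<close>
    define T where "T = A * ln 2 / (2 - A) + 1"
    have "T > 0" using \<open>\<not> 2 \<le> A\<close> A(1) unfolding T_def by (intro add_nonneg_pos) auto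
    define t where "t = exp (- T)"
    have t: "0 < t" "t < 1" using \<open>T > 0\<close> by (auto simp: t_def)
    note ax = ell.qh_dist_minor_axis_ge[OF t, folded E]
    have "2 * ln (1 / t) \<le> A * ln (2 / t)"
      using ax(3) A(2)[rule_format, OF ax(1,2)] mult_left_mono[OF ax(4), of A] A(1) by linarith
    then have "2 * T \<le> A * (ln 2 + T)" by (simp add: t_def ln_div)
    then have "(2 - A) * T \<le> A * ln 2" by (simp add: algebra_simps)
    moreover have "(2 - A) * T = A * ln 2 + (2 - A)"
      using \<open>\<not> 2 \<le> A\<close> by (simp add: T_def field_simps)
    ultimately show False using \<open>\<not> 2 \<le> A\<close> by simp
  qed
  then have lower1: "ereal 2 \<le> unif_const E"
    unfolding unif_const_def by (intro Inf_greatest) auto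
  have lower2: "ereal (2 * sqrt (c\<^sup>2 - 1) * arcsin (sqrt (1 - 1 / c\<^sup>2)) / ln (2 * c\<^sup>2 - 1)) \<le> unif_const E"
    if "c > 1"
  proof -
    have "b < a" using that assms by simp
    note ax = ell.qh_dist_major_axis_ge[OF this, folded E assms(7)]
    have "1 < c\<^sup>2" using that by simp
    then have "0 < ln (2 * c\<^sup>2 - 1)" by simp
    have "2 * sqrt (c\<^sup>2 - 1) * arcsin (sqrt (1 - 1 / c\<^sup>2)) / ln (2 * c\<^sup>2 - 1) \<le> A"
      if A: "A \<ge> 1" "\<forall>x\<in>E. \<forall>y\<in>E. qh_dist E x y \<le> A * j_dist E x y" for A
    proof -
      have "2 * sqrt (c\<^sup>2 - 1) * arcsin (sqrt (1 - 1 / c\<^sup>2)) \<le> A * ln (2 * c\<^sup>2 - 1)"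
        using ax(3) A(2)[rule_format, OF ax(1,2)] mult_left_mono[OF ax(4), of A] A(1) by linarith
      then show ?thesis using \<open>0 < ln (2 * c\<^sup>2 - 1)\<close> by (simp add: pos_divide_le_eq)
    qed
    then show ?thesis unfolding unif_const_def by (intro Inf_greatest) auto
  qed
  have "qh_dist E x y \<le> 2 * c ^ 4 * j_dist E x y" if "x \<in> E" "y \<in> E" for x y
  proof -
    have "qh_dist E x y \<le> 2 * c\<^sup>2 * j_dist E x y"
      using ell.qh_dist_le_j_dist that unfolding E assms(7) by blast
    \<comment> \<open>The weakening from \<open>c\<^sup>2\<close> to \<open>c ^ 4\<close> uses
      \<open>c \<ge> 1\<close> and the nonnegativity of \<open>j_dist\<close>.\<close>
    also have "\<dots> \<le> 2 * c ^ 4 * j_dist E x y"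
    proof (rule mult_right_mono)
      show "2 * c\<^sup>2 \<le> 2 * c ^ 4" using power_increasing[of 2 4 c] \<open>c \<ge> 1\<close> by simp
      have "0 \<le> min (bdist E x) (bdist E y)" by (simp add: bdist_def infdist_nonneg)
      then show "0 \<le> j_dist E x y" by (simp add: j_dist_def)
    qed
    finally show ?thesis .
  qed
  moreover have "1 \<le> 2 * c ^ 4" using one_le_power[OF \<open>c \<ge> 1\<close>, of 4] by linarith
  ultimately have "unif_const E \<le> ereal (2 * c ^ 4)"
    unfolding unif_const_def by (intro Inf_lower) blast
  with lower1 lower2 show ?thesis by blast
qed

end
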